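(* Let $k\geq t+2\geq 4$ and let $\mathcal{F},\mathcal{G}\subseteq\binom{[n]}{k}$ be cross $t$-intersecting with $\left|\bigcap_{F\in\mathcal{F}\cup\mathcal{G}}F\right|<t$. If $n\geq t+(k-t)\cdot\max\{30(t+2),\,2ek\}$, then $$\min\{|\mathcal{F}|,|\mathcal{G}|\}\leq\max\{|\mathcal{A}(n,k,t)|,|\mathcal{H}(n,k,t)|\}.$$ Moreover, if equality holds, then either (i) there exist $X\in\binom{[n]}{t}$ and $K,L\in\binom{[n]}{k+1}$ with $X\subseteq K\cap L$ and $|K\cap L|\geq t+2$ such that $\mathcal{F}=\mathcal{H}(X,K,L)$ and $\mathcal{G}=\mathcal{H}(X,L,K)$, or (ii) there exists $Z\in\binom{[n]}{t+2}$ such that $\mathcal{F}=\mathcal{G}=\mathcal{A}(Z)$.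
   Context: $n,k,t$ are positive integers, $[n]=\{1,\dots,n\}$, $[i,j]=\{i,i+1,\dots,j\}$, $\binom{[n]}{k}$ is the family of all $k$-subsets of $[n]$, and $e$ is the base of the natural logarithm. Families $\mathcal{F},\mathcal{G}$ are cross $t$-intersecting if $|F\cap G|\ge t$ for all $F\in\mathcal{F}$, $G\in\mathcal{G}$. For $Z\in\binom{[n]}{t+2}$, $\mathcal{A}(Z)=\{F\in\binom{[n]}{k}:|F\cap Z|\geq t+1\}$, and $\mathcal{A}(n,k,t)=\mathcal{A}([t+2])$. For $X\in\binom{[n]}{t}$ and $K,L\in\binom{[n]}{k+1}$ with $X\subseteq K\cap L$, $$\mathcal{H}(X,K,L)=\left\{F\in\binom{[n]}{k}:X\subseteq F,\ F\cap(L\setminus X)\neq\emptyset\right\}\cup\{K\setminus\{x\}:x\in X\},$$ and $\mathcal{H}(n,k,t)=\mathcal{H}([t],[k+1],[k+1])=\{F\in\binom{[n]}{k}:[t]\subseteq F,\ F\cap[t+1,k+1]\neq\emptyset\}\cup\{[k+1]\setminus\{i\}:i\in[t]\}$. *)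

theory Defs
  imports Complex_Main "HOL-Library.Ramsey"
begin

text \<open>
  The family of all \<open>k\<close>-subsets of \<open>[n]\<close> is \<^term>\<open>nsets {1..n} k\<close>.
\<close>

definition cross_intersecting :: "nat \<Rightarrow> nat set set \<Rightarrow> nat set set \<Rightarrow> bool" where
  "cross_intersecting t \<F> \<G> \<longleftrightarrow> (\<forall>F\<in>\<F>. \<forall>G\<in>\<G>. card (F \<inter> G) \<ge> t)"

definition famA :: "nat \<Rightarrow> nat \<Rightarrow> nat \<Rightarrow> nat set \<Rightarrow> nat set set" where
  "famA n k t Z = {F \<in> nsets {1..n} k. card (F \<inter> Z) \<ge> t + 1}"

definition famA_std :: "nat \<Rightarrow> nat \<Rightarrow> nat \<Rightarrow> nat set set" where
  "famA_std n k t = famA n k t {1..t + 2}"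

definition famH :: "nat \<Rightarrow> nat \<Rightarrow> nat set \<Rightarrow> nat set \<Rightarrow> nat set \<Rightarrow> nat set set" where
  "famH n k X K L =
     {F \<in> nsets {1..n} k. X \<subseteq> F \<and> F \<inter> (L - X) \<noteq> {}} \<union> {K - {x} | x. x \<in> X}"

definition famH_std :: "nat \<Rightarrow> nat \<Rightarrow> nat \<Rightarrow> nat set set" where
  "famH_std n k t = famH n k {1..t} {1..k + 1} {1..k + 1}"

lemma famH_std_explicit:
  "famH_std n k t =
     {F \<in> nsets {1..n} k. {1..t} \<subseteq> F \<and> F \<inter> {t + 1..k + 1} \<noteq> {}}
       \<union> {{1..k + 1} - {i} | i. i \<in> {1..t}}"
proof -
  have "{1..k + 1} - {1..t} = {t + 1..k + 1}"
    by auto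
  then show ?thesis
    by (simp add: famH_std_def famH_def)
qed

end

theory Submission
  imports Defs
begin

text \<open>
  Starting from \<open>(\<F>, \<G>)\<close>, shrink members of the two families one point at a time as long as they
  stay cross \<open>t\<close>-intersecting. When this is no longer possible, every proper subset of a member is
  met in fewer than \<open>t\<close> points by some member of the other family, and a branching argument
  bounds the number of members of the maximal size \<open>t + q\<close> by \<open>(t + q choose t) (q + 1)^q\<close>. Discard
  these and repeat with \<open>q - 1\<close>. The lower bound on \<open>n\<close> makes the loss over all \<open>q \<ge> 2\<close> a small
  fraction of the threshold, and all but this fraction of \<open>\<F>\<close> and \<open>\<G>\<close> is generated by cross
  \<open>t\<close>-intersecting kernels consisting of sets of size at most \<open>t + 1\<close>. Each kernel is large, so
  either all kernel sets share a \<open>t\<close>-set \<open>X\<close>, or they all lie in a \<open>(t + 2)\<close>-set \<open>Z\<close>. In the second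
  case a single set outside \<open>\<A>(Z)\<close> would already make the other family too small. In the first
  case the members not containing \<open>X\<close> must all miss exactly one point of \<open>X\<close> and agree outside
  \<open>X\<close>, which gives \<open>\<H>(X, K, L)\<close>.
\<close>

section \<open>Counting lemmas\<close>

text \<open>Peeling has to stop at size \<open>t + 1\<close>: one more round would cost
  \<open>T 1 = 2 (t + 1)\<close> units of \<open>N\<close>, more than the roughly
  \<open>t + 2\<close> units in \<A>(n,k,t). This is why kernels of \<open>t\<close>-sets and
  \<open>(t + 1)\<close>-sets have to be classified structurally. The two terms in the bound on
  \<open>n\<close> have separate duties. The term \<open>2 e k\<close> makes successive costs halve,
  because passing from \<open>q\<close> to \<open>q + 1\<close> multiplies \<open>T q\<close> by at
  most \<open>e (t + q + 1) p\<close>. The term \<open>30 (t + 2)\<close> makes the first cost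
  \<open>T 2\<close> small against \<open>t + 2\<close>. Inequality and equality are proved
  together: two families at least as large as both candidates form one of the extremal pairs, and
  these have exactly the size of a candidate. Both candidates are used at once: \<A> gives a lower
  bound growing with \<open>t\<close>, \<H> one growing with \<open>w = k - t\<close>, and neither
  parameter controls the other. In the star case the decisive step is a balance: a second trace
  outside \<open>X\<close> costs the other family at least \<open>22/27 N\<close>, while fewer than
  \<open>22/27 N\<close> of its members fail to contain \<open>X\<close>.\<close>

lemma card_nsets_trace:
  assumes V: "finite V" and Z: "Z \<subseteq> V" and S: "S \<subseteq> Z" and k: "card S \<le> k"
  shows "card {F \<in> nsets V k. F \<inter> Z = S} = (card V - card Z) choose (k - card S)"
proof -
  have fin: "finite Z" "finite S" by (rule finite_subset[OF Z V], rule finite_subset[OF S finite_subset[OF Z V]])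
  have "bij_betw (\<lambda>F. F - Z) {F \<in> nsets V k. F \<inter> Z = S} (nsets (V - Z) (k - card S))"
  proof (rule bij_betwI[where g = "\<lambda>G. G \<union> S"])
    show "(\<lambda>F. F - Z) \<in> {F \<in> nsets V k. F \<inter> Z = S} \<rightarrow> nsets (V - Z) (k - card S)"
    proof
      fix F assume F: "F \<in> {F \<in> nsets V k. F \<inter> Z = S}"
      then have "F - Z = F - S" and "S \<subseteq> F" by auto
      then have "card (F - Z) = card F - card S" using fin by (simp add: card_Diff_subset)
      then show "F - Z \<in> nsets (V - Z) (k - card S)" using F by (auto simp: nsets_def)
    qed
    show "(\<lambda>G. G \<union> S) \<in> nsets (V - Z) (k - card S) \<rightarrow> {F \<in> nsets V k. F \<inter> Z = S}"
    proof
      fix G assume G: "G \<in> nsets (V - Z) (k - card S)"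
      then have "G \<inter> S = {}" "finite G" using S by (auto simp: nsets_def)
      then have "card (G \<union> S) = card G + card S" using fin by (simp add: card_Un_disjoint)
      then show "G \<union> S \<in> {F \<in> nsets V k. F \<inter> Z = S}"
        using G k fin S Z by (auto simp: nsets_def)
    qed
  qed (use S in \<open>auto simp: nsets_def\<close>)
  then have "card {F \<in> nsets V k. F \<inter> Z = S} = card (nsets (V - Z) (k - card S))"
    by (rule bij_betw_same_card)
  also have "\<dots> = (card V - card Z) choose (k - card S)"
  proof -
    have "nsets (V - Z) (k - card S) = {B. B \<subseteq> V - Z \<and> card B = k - card S}"
      using V by (auto simp: nsets_def intro: finite_subset)
    then show ?thesis using V Z fin by (simp add: n_subsets card_Diff_subset)
  qed
  finally show ?thesis .
qed

lemma card_nsets_superset: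
  assumes "finite V" and "T \<subseteq> V" and "card T \<le> k"
  shows "card {F \<in> nsets V k. T \<subseteq> F} = (card V - card T) choose (k - card T)"
proof -
  have "{F \<in> nsets V k. T \<subseteq> F} = {F \<in> nsets V k. F \<inter> T = T}" by auto
  then show ?thesis using card_nsets_trace[OF assms(1,2) order_refl assms(3)] by simp
qed

lemma finite_nsets_sub: "finite V \<Longrightarrow> \<A> \<subseteq> nsets V K \<Longrightarrow> finite \<A>"
  using finite_imp_finite_nsets finite_subset by blast

lemma card_hitting_nsets:
  assumes V: "finite V" and X: "X \<subseteq> V" and D: "D \<subseteq> V - X" and k: "card X \<le> k"
  shows "card {F \<in> nsets V k. X \<subseteq> F \<and> F \<inter> D \<noteq> {}} =
    ((card V - card X) choose (k - card X)) - ((card V - card X - card D) choose (k - card X))"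
proof -
  let ?A = "{F \<in> nsets V k. X \<subseteq> F}" and ?B = "{F \<in> nsets V k. F \<inter> (X \<union> D) = X}"
  have fin: "finite X" "finite D"
    by (rule finite_subset[OF X V], rule finite_subset[OF D finite_Diff[OF V]])
  have eq: "{F \<in> nsets V k. X \<subseteq> F \<and> F \<inter> D \<noteq> {}} = ?A - ?B" using D by auto
  have "card (X \<union> D) = card X + card D" using fin D by (intro card_Un_disjoint) auto
  moreover have "finite ?B" using V by (simp add: finite_imp_finite_nsets)
  moreover have "?B \<subseteq> ?A" by auto
  ultimately show ?thesis
    unfolding eq using card_nsets_superset[OF V X k] card_nsets_trace[of V "X \<union> D" X k] V X D k
    by (simp add: card_Diff_subset le_supI subset_iff)
qed

text \<open>A set meeting \<open>B\<close> in \<open>t\<close> points misses at most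
  \<open>q\<close> points of \<open>B\<close>, so it hits any \<open>q + 1\<close> of them. If
  \<open>B - T\<close> is smaller than that, all of it serves, since \<open>T \<inter> B\<close>
  alone cannot supply \<open>t\<close> points. \<open>D\<close> is the list of choices at a node of
  most branchings below.\<close>

lemma meeting_set:
  fixes t q :: nat
  assumes B: "finite B" "card B \<le> t + q" and T: "card (T \<inter> B) < t"
  shows "\<exists>D. finite D \<and> card D \<le> q + 1 \<and> D \<subseteq> B - T \<and> (\<forall>A. card (A \<inter> B) \<ge> t \<longrightarrow> A \<inter> D \<noteq> {})"
proof (cases "card (B - T) \<le> q + 1")
  case True
  have "A \<inter> (B - T) \<noteq> {}" if "card (A \<inter> B) \<ge> t" for A
  proof
    assume "A \<inter> (B - T) = {}"
    then have "A \<inter> B \<subseteq> T \<inter> B" by auto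
    then have "card (A \<inter> B) \<le> card (T \<inter> B)" using B by (intro card_mono) auto
    then show False using that T by simp
  qed
  then show ?thesis using True B(1) by (intro exI[of _ "B - T"]) simp
next
  case False
  then obtain D where D: "D \<subseteq> B - T" "card D = q + 1" "finite D"
    using obtain_subset_with_card_n[of "q + 1" "B - T"] by (metis nat_le_linear)
  have "A \<inter> D \<noteq> {}" if "card (A \<inter> B) \<ge> t" for A
  proof
    assume "A \<inter> D = {}"
    then have "A \<inter> B \<subseteq> B - D" by auto
    then have "card (A \<inter> B) \<le> card (B - D)" using B by (intro card_mono) auto
    also have "\<dots> = card B - card D" using D by (intro card_Diff_subset) auto
    finally have "card (A \<inter> B) \<le> card B - card D" .
    moreover have "card D \<le> card B" using D B by (intro card_mono) auto
    ultimately show False using that B D by simp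
  qed
  then show ?thesis using D by (intro exI[of _ D]) simp
qed

text \<open>A search tree: each \<open>A\<close> above \<open>T\<close> contains one of at most
  \<open>c\<close> new points, so after \<open>r - card T\<close> extensions only supersets of
  \<open>r\<close>-sets are left to count. The root \<open>T0\<close> lets a caller use that every
  node contains it.\<close>

lemma card_branching:
  fixes c r K :: nat
  assumes V: "finite V" and \<A>: "\<A> \<subseteq> nsets V K"
    and step: "\<And>T. T0 \<subseteq> T \<Longrightarrow> T \<subseteq> V \<Longrightarrow> card T < r \<Longrightarrow>
      \<exists>C. finite C \<and> card C \<le> c \<and> C \<inter> T = {} \<and> (\<forall>A\<in>\<A>. T \<subseteq> A \<longrightarrow> A \<inter> C \<noteq> {})"
    and T: "T0 \<subseteq> T" "T \<subseteq> V" "card T \<le> r"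
  shows "card {A \<in> \<A>. T \<subseteq> A} \<le> c ^ (r - card T) * ((card V - r) choose (K - r))"
  using T
proof (induction "r - card T" arbitrary: T)
  case 0
  then have r: "card T = r" by simp
  have "card {A \<in> \<A>. T \<subseteq> A} \<le> (card V - r) choose (K - r)"
  proof (cases "card T \<le> K")
    case True
    have "card {A \<in> \<A>. T \<subseteq> A} \<le> card {F \<in> nsets V K. T \<subseteq> F}"
      using V \<A> by (intro card_mono) (auto simp: finite_imp_finite_nsets)
    then show ?thesis using card_nsets_superset[OF V _ True] 0 r by simp
  next
    case False
    \<comment> \<open>Here \<open>r > K\<close>, so the truncated \<open>K - r\<close> is 0 and the
      binomial is 1, while no member is large enough to contain \<open>T\<close>.\<close>
    have "\<not> T \<subseteq> A" if "A \<in> \<A>" for A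
      using that False \<A> card_mono[of A T] by (auto simp: nsets_def)
    then have "{A \<in> \<A>. T \<subseteq> A} = {}" by blast
    then show ?thesis by (simp only: card.empty zero_le)
  qed
  then show ?case by (simp add: r)
next
  case (Suc d)
  have "card T < r" using Suc(2) by linarith
  from step[OF Suc(3,4) this] obtain C where C: "finite C" "card C \<le> c" "C \<inter> T = {}"
    "\<forall>A\<in>\<A>. T \<subseteq> A \<longrightarrow> A \<inter> C \<noteq> {}" by (elim exE conjE)
  have finT: "finite T" by (rule finite_subset[OF Suc(4) V])
  have bound: "card {A \<in> \<A>. insert x T \<subseteq> A} \<le> c ^ d * ((card V - r) choose (K - r))"
    if "x \<in> C \<inter> V" for x
  proof -
    have x: "x \<in> V" "x \<notin> T" using that C(3) by auto
    then have c: "card (insert x T) = Suc (card T)" using finT by simp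
    then have d: "d = r - card (insert x T)" using Suc(2) by simp
    show ?thesis unfolding d
    proof (rule Suc(1)[OF d])
      show "T0 \<subseteq> insert x T" "insert x T \<subseteq> V" using Suc(3,4) x by auto
      show "card (insert x T) \<le> r" using c \<open>card T < r\<close> by simp
    qed
  qed
  have "card {A \<in> \<A>. T \<subseteq> A} \<le> card (\<Union>x\<in>C \<inter> V. {A \<in> \<A>. insert x T \<subseteq> A})"
  proof (rule card_mono)
    show "finite (\<Union>x\<in>C \<inter> V. {A \<in> \<A>. insert x T \<subseteq> A})"
      using finite_nsets_sub[OF V \<A>] C by auto
    show "{A \<in> \<A>. T \<subseteq> A} \<subseteq> (\<Union>x\<in>C \<inter> V. {A \<in> \<A>. insert x T \<subseteq> A})"
    proof
      fix A assume A: "A \<in> {A \<in> \<A>. T \<subseteq> A}"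
      then have "A \<inter> C \<noteq> {}" using C(4) by simp
      then obtain x where "x \<in> A" "x \<in> C" by auto
      moreover have "A \<subseteq> V" using A \<A> by (auto simp: nsets_def)
      ultimately show "A \<in> (\<Union>x\<in>C \<inter> V. {A \<in> \<A>. insert x T \<subseteq> A})" using A by auto
    qed
  qed
  also have "\<dots> \<le> (\<Sum>x\<in>C \<inter> V. card {A \<in> \<A>. insert x T \<subseteq> A})"
    using C by (intro card_UN_le) auto
  also have "\<dots> \<le> (\<Sum>x\<in>C \<inter> V. c ^ d * ((card V - r) choose (K - r)))"
    using bound by (intro sum_mono)
  also have "\<dots> = card (C \<inter> V) * (c ^ d * ((card V - r) choose (K - r)))" by simp
  also have "\<dots> \<le> c * (c ^ d * ((card V - r) choose (K - r)))"
    using C card_mono[of C "C \<inter> V"] by (intro mult_right_mono) auto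
  also have "\<dots> = c ^ (r - card T) * ((card V - r) choose (K - r))"
    using Suc(2) by (metis mult.assoc power_Suc)
  finally show ?case .
qed

section \<open>Two cross \<open>t\<close>-intersecting families of \<open>(t+1)\<close>-sets\<close>

lemma cross_intersecting_sym: "cross_intersecting t \<F> \<G> \<longleftrightarrow> cross_intersecting t \<G> \<F>"
  unfolding cross_intersecting_def by (metis Int_commute)

text \<open>\<open>A\<close> lacks at most one point of \<open>B\<close>, and \<open>x\<close> is
  that point.\<close>

lemma Diff_singleton_subset_of_card:
  assumes "finite B" and "card B \<le> Suc (card (A \<inter> B))" and "x \<in> B" and "x \<notin> A"
  shows "B - {x} \<subseteq> A"
proof -
  have sub: "A \<inter> B \<subseteq> B - {x}" using assms by auto
  have "card (B - {x}) \<le> card (A \<inter> B)" using assms by simp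
  then have "A \<inter> B = B - {x}" using sub assms(1) by (intro card_seteq) auto
  then show ?thesis by auto
qed

text \<open>If \<open>A\<close> lacked a point of \<open>X\<close>, it would contain the rest of
  each \<open>Q i\<close>: the \<open>t - 1\<close> other points of \<open>X\<close> and three
  petals, \<open>t + 2\<close> points in all. Two petals would not yield a contradiction.\<close>

lemma superset_of_star:
  assumes X: "finite X" "card X = t"
    and Q: "\<And>i. i \<in> {0, 1, 2::nat} \<Longrightarrow> finite (Q i) \<and> card (Q i) = t + 1 \<and> X \<subseteq> Q i"
    and dist: "Q 0 \<noteq> Q 1" "Q 0 \<noteq> Q 2" "Q 1 \<noteq> Q 2"
    and A: "finite A" "card A \<le> t + 1" "\<And>i. i \<in> {0, 1, 2} \<Longrightarrow> card (A \<inter> Q i) \<ge> t"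
  shows "X \<subseteq> A"
proof
  fix x assume x: "x \<in> X"
  have "\<exists>z. Q i = insert z X \<and> z \<notin> X" if "i \<in> {0, 1, 2}" for i
  proof -
    have "card (Q i - X) = 1" using Q[OF that] X by (simp add: card_Diff_subset)
    then obtain z where "Q i - X = {z}" by (rule card_1_singletonE)
    then show ?thesis using Q[OF that] by auto
  qed
  then obtain z where z: "\<And>i. i \<in> {0, 1, 2} \<Longrightarrow> Q i = insert (z i) X \<and> z i \<notin> X" by metis
  then have z012: "Q 0 = insert (z 0) X" "Q 1 = insert (z 1) X" "Q 2 = insert (z 2) X" 
    "z 0 \<notin> X" "z 1 \<notin> X" "z 2 \<notin> X" by simp_all
  show "x \<in> A"
  proof (rule ccontr)
    assume nx: "x \<notin> A"
    have sub: "Q i - {x} \<subseteq> A" if "i \<in> {0, 1, 2}" for i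
      using Diff_singleton_subset_of_card[of "Q i" A x] Q[OF that] A(3)[OF that] x nx by auto
    have "z 0 \<in> Q 0 - {x}" "z 1 \<in> Q 1 - {x}" "z 2 \<in> Q 2 - {x}" using z012 x by simp_all blast+
    then have zA: "z 0 \<in> A" "z 1 \<in> A" "z 2 \<in> A"
      using subsetD[OF sub[of 0]] subsetD[OF sub[of 1]] subsetD[OF sub[of 2]] by simp_all
    have "X - {x} \<subseteq> A" using sub[of 0] z012(1) by (simp add: subset_iff)
    then have "insert (z 0) (insert (z 1) (insert (z 2) (X - {x}))) \<subseteq> A"
      using zA by (intro insert_subsetI)
    from card_mono[OF A(1) this]
    have "card (insert (z 0) (insert (z 1) (insert (z 2) (X - {x})))) \<le> t + 1"
      using A(2) by (rule le_trans)
    moreover have "z 0 \<noteq> z 1" "z 0 \<noteq> z 2" "z 1 \<noteq> z 2" using dist z012(1-3) by auto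
    then have "card (insert (z 0) (insert (z 1) (insert (z 2) (X - {x})))) = t - 1 + 3"
      using z012(4-6) X x by simp
    moreover have "t > 0" using X x by (auto simp: card_gt_0_iff)
    ultimately show False by simp
  qed
qed

text \<open>The three sets either form a sunflower with a core of \<open>t\<close> points or lie in
  a common \<open>(t + 2)\<close>-set; either shape is passed on to every \<open>A\<close> close to
  all three.\<close>

lemma three_close_sets:
  assumes Q: "\<And>i. i \<in> {0, 1, 2::nat} \<Longrightarrow> finite (Q i) \<and> card (Q i) = t + 1"
    and dist: "Q 0 \<noteq> Q 1" "Q 0 \<noteq> Q 2" "Q 1 \<noteq> Q 2"
    and close: "card (Q 0 \<inter> Q 1) = t" "card (Q 0 \<inter> Q 2) = t" "card (Q 1 \<inter> Q 2) = t"
  shows "(\<exists>X. finite X \<and> card X = t \<and> (\<forall>A. finite A \<longrightarrow> card A = t + 1 \<longrightarrow>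
            (\<forall>i\<in>{0, 1, 2}. card (A \<inter> Q i) \<ge> t) \<longrightarrow> X \<subseteq> A)) \<or>
         (\<exists>Z. finite Z \<and> card Z = t + 2 \<and> (\<forall>A. finite A \<longrightarrow> card A = t + 1 \<longrightarrow>
            (\<forall>i\<in>{0, 1, 2}. card (A \<inter> Q i) \<ge> t) \<longrightarrow> A \<subseteq> Z))"
proof (cases "Q 0 \<inter> Q 1 \<subseteq> Q 2")
  case True
  have sub: "\<And>i. i \<in> {0, 1, 2::nat} \<Longrightarrow> finite (Q i) \<and> card (Q i) = t + 1 \<and> Q 0 \<inter> Q 1 \<subseteq> Q i"
    using True Q by auto
  have fin: "finite (Q 0 \<inter> Q 1)" using Q by simp
  have "Q 0 \<inter> Q 1 \<subseteq> A" if "finite A" "card A = t + 1" "\<forall>i\<in>{0, 1, 2}. card (A \<inter> Q i) \<ge> t" for A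
    using superset_of_star[OF fin close(1) sub dist that(1)] that(2,3) by simp
  then show ?thesis using fin close(1) by (intro disjI1) blast
next
  case False
  then obtain x where x: "x \<in> Q 0" "x \<in> Q 1" "x \<notin> Q 2" by auto
  define Z where "Z = Q 0 \<union> Q 1"
  have Z: "finite Z" "card Z = t + 2"
    using Q card_Un_Int[of "Q 0" "Q 1"] close(1) by (auto simp: Z_def)
  have "A \<subseteq> Z" if A: "finite A" "card A = t + 1" "\<forall>i\<in>{0, 1, 2}. card (A \<inter> Q i) \<ge> t" for A
  proof (rule ccontr)
    assume "\<not> A \<subseteq> Z"
    then have "A \<inter> Z \<subset> A" by auto
    from psubset_card_mono[OF A(1) this] have le: "card (A \<inter> Z) \<le> t" using A(2) by simp
    have Q2: "Q 2 \<subseteq> Z"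
    proof -
      have "Q 0 - {x} \<subseteq> Q 2" "Q 1 - {x} \<subseteq> Q 2"
        using Diff_singleton_subset_of_card[of "Q 0" "Q 2" x] Diff_singleton_subset_of_card[of "Q 1" "Q 2" x]
          Q close x by (auto simp: Int_commute)
      then have "Z - {x} \<subseteq> Q 2" by (auto simp: Z_def)
      moreover have "card (Z - {x}) = t + 1" using Z x by (simp add: Z_def)
      ultimately have "Z - {x} = Q 2" using Q[of 2] by (intro card_seteq) auto
      then show ?thesis by auto
    qed
    \<comment> \<open>At most \<open>t\<close> points of \<open>A\<close> lie in \<open>Z\<close>,
      so a trace of at least \<open>t\<close> points on \<open>Q i\<close> is all of
      \<open>A \<inter> Z\<close>. Hence \<open>A \<inter> Z\<close> lies in all three
      \<open>Q i\<close>, whose common part has at most \<open>t - 1\<close> points.\<close>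
    have eq: "A \<inter> Q i = A \<inter> Z" if i: "i \<in> {0, 1, 2}" for i
    proof (rule card_seteq)
      show "A \<inter> Q i \<subseteq> A \<inter> Z" using i Q2 by (auto simp: Z_def)
      have "t \<le> card (A \<inter> Q i)" using A(3) i by blast
      then show "card (A \<inter> Z) \<le> card (A \<inter> Q i)" using le by linarith
    qed (use A in auto)
    have "A \<inter> Z \<subseteq> (Q 0 \<inter> Q 1) - {x}" using eq[of 0] eq[of 1] eq[of 2] x by auto
    moreover have "finite (Q 0 \<inter> Q 1)" using Q by simp
    ultimately have "card (A \<inter> Z) \<le> card (Q 0 \<inter> Q 1 - {x})" by (intro card_mono) auto
    also have "\<dots> = t - 1" using x close(1) by simp
    finally have "card (A \<inter> Z) \<le> t - 1" .
    moreover have "t \<le> card (A \<inter> Z)" using eq[of 0] A(3) by force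
    moreover have "t > 0"
      using close(1) x Q[of 0] card_gt_0_iff[of "Q 0 \<inter> Q 1"] by auto
    ultimately show False by simp
  qed
  then show ?thesis using Z by (intro disjI2) blast
qed

text \<open>If two members of \<open>\<Q>\<close> met in only \<open>t - 1\<close> points, then \<open>\<P>\<close> would consist of exactly the
  four sets arising from a 4-cycle on their symmetric difference, and this 4-cycle has only
  two vertex covers of size two.\<close>

lemma cross_intersecting_close:
  assumes P: "\<And>A. A \<in> \<P> \<Longrightarrow> finite A \<and> card A = t + 1"
    and Q: "\<And>A. A \<in> \<Q> \<Longrightarrow> finite A \<and> card A = t + 1"
    and cross: "cross_intersecting t \<P> \<Q>" and P4: "card \<P> \<ge> 4" and Q3: "card \<Q> \<ge> 3"
    and Q12: "Q1 \<in> \<Q>" "Q2 \<in> \<Q>" "Q1 \<noteq> Q2"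
  shows "card (Q1 \<inter> Q2) = t"
proof (rule ccontr)
  assume neq: "card (Q1 \<inter> Q2) \<noteq> t"
  define C where "C = Q1 \<inter> Q2"
  have fin: "finite Q1" "finite Q2" "finite C" using Q Q12 by (auto simp: C_def)
  have cr: "t \<le> card (A \<inter> B)" if "A \<in> \<P>" "B \<in> \<Q>" for A B
    using cross that by (auto simp: cross_intersecting_def)
  have "Q1 \<inter> Q2 \<subset> Q1"
  proof (rule psubsetI)
    show "Q1 \<inter> Q2 \<noteq> Q1"
    proof
      assume "Q1 \<inter> Q2 = Q1"
      then have "Q1 \<subseteq> Q2" by auto
      then have "Q1 = Q2" using Q Q12 by (intro card_seteq) auto
      then show False using Q12 by simp
    qed
  qed auto
  then have "card C < t + 1" using psubset_card_mono[OF fin(1)] Q[OF Q12(1)] by (simp add: C_def)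
  then have Clt: "card C \<le> t - 1" "t > 0" using neq by (auto simp: C_def)
  \<comment> \<open>The traces on \<open>Q1\<close> and \<open>Q2\<close> have at least
    \<open>t\<close> points each inside a \<open>(t + 1)\<close>-set, so they share at least
    \<open>t - 1\<close>. This forces \<open>C\<close> to have exactly \<open>t - 1\<close> points
    and to lie in every \<open>A\<close>.\<close>
  have inter: "t - 1 \<le> card (A \<inter> C)" if A: "A \<in> \<P>" for A
  proof -
    have fA: "finite A" "card A = t + 1" using P A by auto
    have "card (A \<inter> Q1) + card (A \<inter> Q2) = card ((A \<inter> Q1) \<union> (A \<inter> Q2)) + card ((A \<inter> Q1) \<inter> (A \<inter> Q2))"
      using fA by (intro card_Un_Int) auto
    moreover have "card ((A \<inter> Q1) \<union> (A \<inter> Q2)) \<le> t + 1"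
      unfolding fA(2)[symmetric] using fA by (intro card_mono) auto
    moreover have "(A \<inter> Q1) \<inter> (A \<inter> Q2) = A \<inter> C" by (auto simp: C_def)
    ultimately show ?thesis using cr[OF A Q12(1)] cr[OF A Q12(2)] by simp
  qed
  have "\<P> \<noteq> {}" using P4 by auto
  then obtain A0 where A0: "A0 \<in> \<P>" by auto
  have Ct: "card C = t - 1"
    using inter[OF A0] card_mono[of C "A0 \<inter> C"] fin Clt by auto
  have CA: "C \<subseteq> A" if "A \<in> \<P>" for A
  proof -
    have "A \<inter> C = C" using inter[OF that] Ct fin by (intro card_seteq) auto
    then show ?thesis by auto
  qed
  have "card (Q1 - C) = 2" "card (Q2 - C) = 2"
    using card_Diff_subset[of C Q1] card_Diff_subset[of C Q2] Q Q12 fin(3) Ct Clt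
    unfolding C_def by auto
  then obtain a b c d where ab: "Q1 - C = {a, b}" "a \<noteq> b" and cd: "Q2 - C = {c, d}" "c \<noteq> d"
    unfolding card_2_iff by auto
  have notC: "a \<notin> C" "b \<notin> C" "c \<notin> C" "d \<notin> C" using ab cd by auto
  have "a \<in> Q1 - C" "b \<in> Q1 - C" "c \<in> Q2 - C" "d \<in> Q2 - C" using ab cd by auto
  then have dis: "a \<noteq> c" "a \<noteq> d" "b \<noteq> c" "b \<noteq> d" by (auto simp: C_def)
  have Q1eq: "Q1 = C \<union> {a, b}" and Q2eq: "Q2 = C \<union> {c, d}"
    using ab(1) cd(1) by (auto simp: C_def)
  \<comment> \<open>The edges of the 4-cycle \<open>a c b d\<close>, each joined to
    \<open>C\<close>.\<close>
  let ?W = "{C \<union> {a, c}, C \<union> {a, d}, C \<union> {b, c}, C \<union> {b, d}}"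
  have sub: "\<P> \<subseteq> ?W"
  proof
    fix A assume A: "A \<in> \<P>"
    have fA: "finite A" "card A = t + 1" using P A by auto
    have "A \<inter> {a, b} \<noteq> {}"
    proof
      assume "A \<inter> {a, b} = {}"
      then have "A \<inter> Q1 \<subseteq> C" unfolding Q1eq by auto
      from card_mono[OF fin(3) this] show False using cr[OF A Q12(1)] Ct Clt by simp
    qed
    moreover have "A \<inter> {c, d} \<noteq> {}"
    proof
      assume "A \<inter> {c, d} = {}"
      then have "A \<inter> Q2 \<subseteq> C" unfolding Q2eq by auto
      from card_mono[OF fin(3) this] show False using cr[OF A Q12(2)] Ct Clt by simp
    qed
    ultimately obtain u v where uv: "u \<in> {a, b}" "v \<in> {c, d}" "u \<in> A" "v \<in> A" by auto
    have "u \<noteq> v" "u \<notin> C" "v \<notin> C" using uv(1,2) dis notC by auto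
    then have "card (C \<union> {u, v}) = t + 1" using Ct Clt fin by simp
    then have "C \<union> {u, v} = A" using CA[OF A] uv fA by (intro card_seteq) auto
    then show "A \<in> ?W" using uv by auto
  qed
  have "card ?W \<le> 4" by (simp add: card_insert_if)
  then have PW: "\<P> = ?W" using sub P4 by (intro card_seteq) auto
  have "\<Q> \<subseteq> {Q1, Q2}"
  proof
    fix B assume B: "B \<in> \<Q>"
    have fB: "finite B" "card B = t + 1" using Q B by auto
    have sz: "card (B \<inter> C) + card (B \<inter> {u, v}) \<ge> t" if "C \<union> {u, v} \<in> ?W" for u v
    proof -
      have "(C \<union> {u, v}) \<inter> B = (B \<inter> C) \<union> (B \<inter> {u, v})" by auto
      then have "card ((C \<union> {u, v}) \<inter> B) \<le> card (B \<inter> C) + card (B \<inter> {u, v})"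
        using card_Un_le[of "B \<inter> C" "B \<inter> {u, v}"] by (simp only:)
      then show ?thesis using cr[of "C \<union> {u, v}" B] that PW B by simp
    qed
    have pairs: "card (B \<inter> {u, v}) = of_bool (u \<in> B) + of_bool (v \<in> B)" if "u \<noteq> v" for u v
      using that by (cases "u \<in> B"; cases "v \<in> B") auto
    have s: "card (B \<inter> C) + (of_bool (a \<in> B) + of_bool (c \<in> B)) \<ge> t"
      "card (B \<inter> C) + (of_bool (a \<in> B) + of_bool (d \<in> B)) \<ge> t"
      "card (B \<inter> C) + (of_bool (b \<in> B) + of_bool (c \<in> B)) \<ge> t"
      "card (B \<inter> C) + (of_bool (b \<in> B) + of_bool (d \<in> B)) \<ge> t"
      using sz[of a c] sz[of a d] sz[of b c] sz[of b d] pairs dis by auto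
    have BC: "card (B \<inter> C) \<le> t - 1" using card_mono[of C "B \<inter> C"] fin Ct by auto
    have CB: "C \<subseteq> B"
    proof (rule ccontr)
      assume "\<not> C \<subseteq> B"
      then have "B \<inter> C \<subset> C" by auto
      then have "card (B \<inter> C) < t - 1" using psubset_card_mono[OF fin(3)] Ct by metis
      \<comment> \<open>When a point of \<open>C\<close> is lacking, every edge has to contribute
        both of its ends.\<close>
      then have all: "a \<in> B" "b \<in> B" "c \<in> B" "d \<in> B" "card (B \<inter> C) \<ge> t - 2" "t \<ge> 2" 
        using s by (auto simp: of_bool_def split: if_splits)
      have "card ((B \<inter> C) \<union> {a, b, c, d}) = card (B \<inter> C) + card {a, b, c, d}"
        using fin notC by (intro card_Un_disjoint) auto
      also have "card {a, b, c, d} = 4" using dis ab cd by simp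
      finally have "card ((B \<inter> C) \<union> {a, b, c, d}) > card B" using all fB by simp
      moreover have "(B \<inter> C) \<union> {a, b, c, d} \<subseteq> B" using all by auto
      ultimately show False using card_mono[OF fB(1)] by (meson not_le)
    qed
    \<comment> \<open>\<open>B\<close> meets all four edges of the cycle, so it contains one of the
      two pairs of opposite vertices.\<close>
    have "(a \<in> B \<and> b \<in> B) \<or> (c \<in> B \<and> d \<in> B)"
      using s BC Clt by (auto simp: of_bool_def split: if_splits)
    then have "Q1 \<subseteq> B \<or> Q2 \<subseteq> B" unfolding Q1eq Q2eq using CB by auto
    then have "Q1 = B \<or> Q2 = B"
      using card_seteq[OF fB(1), of Q1] card_seteq[OF fB(1), of Q2] Q Q12 fB by auto
    then show "B \<in> {Q1, Q2}" by auto
  qed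
  then have "card \<Q> \<le> card {Q1, Q2}" by (intro card_mono) auto
  then show False using Q3 Q12 by simp
qed

text \<open>Any three members of \<Q> are pairwise close, and every set of either family meets each
  of them in at least \<open>t\<close> points: for \<P> by the cross condition, for \<Q> by
  closeness. So \<open>three_close_sets\<close> applies to all sets with the same \<open>X\<close>
  or \<open>Z\<close>.\<close>

lemma cross_intersecting_structure:
  assumes P: "\<And>A. A \<in> \<P> \<Longrightarrow> finite A \<and> card A = t + 1"
    and Q: "\<And>A. A \<in> \<Q> \<Longrightarrow> finite A \<and> card A = t + 1"
    and cross: "cross_intersecting t \<P> \<Q>" and P4: "card \<P> \<ge> 4" and Q3: "card \<Q> \<ge> 3"
  shows "(\<exists>X. finite X \<and> card X = t \<and> (\<forall>A\<in>\<P> \<union> \<Q>. X \<subseteq> A)) \<or>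
         (\<exists>Z. finite Z \<and> card Z = t + 2 \<and> (\<forall>A\<in>\<P> \<union> \<Q>. A \<subseteq> Z))"
proof -
  obtain R where R: "R \<subseteq> \<Q>" "card R = 3" using Q3 by (meson obtain_subset_with_card_n)
  then obtain B0 B1 B2 where B: "R = {B0, B1, B2}" "B0 \<noteq> B1" "B0 \<noteq> B2" "B1 \<noteq> B2"
    unfolding card_3_iff by auto
  define q where "q = (\<lambda>i::nat. if i = 0 then B0 else if i = 1 then B1 else B2)"
  have q: "q 0 = B0" "q 1 = B1" "q 2 = B2" by (simp_all add: q_def)
  have qQ: "q i \<in> \<Q>" for i using R B by (auto simp: q_def)
  have close: "card (q i \<inter> q j) = t" if "q i \<noteq> q j" for i j
    using cross_intersecting_close[OF P Q cross P4 Q3 qQ qQ that] .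
  have meet: "\<forall>i\<in>{0, 1, 2}. card (A \<inter> q i) \<ge> t" if "A \<in> \<P> \<union> \<Q>" for A
  proof
    fix i
    show "card (A \<inter> q i) \<ge> t"
    proof (cases "A \<in> \<P>")
      case True
      then show ?thesis using cross qQ by (auto simp: cross_intersecting_def)
    next
      case False
      then have A: "A \<in> \<Q>" using that by simp
      show ?thesis
      proof (cases "A = q i")
        case True
        then show ?thesis using Q[OF A] by simp
      next
        case False
        then show ?thesis using cross_intersecting_close[OF P Q cross P4 Q3 A qQ] by simp
      qed
    qed
  qed
  have sz: "finite A \<and> card A = t + 1" if "A \<in> \<P> \<union> \<Q>" for A using P Q that by auto
  have "q 0 \<noteq> q 1" "q 0 \<noteq> q 2" "q 1 \<noteq> q 2" using B q by auto
  note three = three_close_sets[of q t, OF Q[OF qQ] this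
      close[OF this(1)] close[OF this(2)] close[OF this(3)]]
  from three show ?thesis
  proof (elim disjE exE conjE)
    fix X
    assume X: "finite X" "card X = t" "\<forall>A. finite A \<longrightarrow> card A = t + 1 \<longrightarrow>
      (\<forall>i\<in>{0, 1, 2}. card (A \<inter> q i) \<ge> t) \<longrightarrow> X \<subseteq> A"
    have "\<forall>A\<in>\<P> \<union> \<Q>. X \<subseteq> A"
    proof
      fix A assume A: "A \<in> \<P> \<union> \<Q>"
      show "X \<subseteq> A" using X(3)[rule_format, of A] sz[OF A] meet[OF A] by simp
    qed
    then show ?thesis using X(1,2) by (intro disjI1 exI[of _ X] conjI)
  next
    fix Z
    assume Z: "finite Z" "card Z = t + 2" "\<forall>A. finite A \<longrightarrow> card A = t + 1 \<longrightarrow>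
      (\<forall>i\<in>{0, 1, 2}. card (A \<inter> q i) \<ge> t) \<longrightarrow> A \<subseteq> Z"
    have "\<forall>A\<in>\<P> \<union> \<Q>. A \<subseteq> Z"
    proof
      fix A assume A: "A \<in> \<P> \<union> \<Q>"
      show "A \<subseteq> Z" using Z(3)[rule_format, of A] sz[OF A] meet[OF A] by simp
    qed
    then show ?thesis using Z(1,2) by (intro disjI2 exI[of _ Z] conjI)
  qed
qed

section \<open>Kernels of sets of size at most \<open>t + 1\<close>\<close>

lemma ex_distinct_triple:
  assumes "card \<S> \<ge> 3"
  shows "\<exists>q :: nat \<Rightarrow> 'a. (\<forall>i. q i \<in> \<S>) \<and> q 0 \<noteq> q 1 \<and> q 0 \<noteq> q 2 \<and> q 1 \<noteq> q 2"
proof -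
  obtain R where R: "R \<subseteq> \<S>" "card R = 3" using assms by (meson obtain_subset_with_card_n)
  then obtain a b c where abc: "R = {a, b, c}" "a \<noteq> b" "a \<noteq> c" "b \<noteq> c"
    unfolding card_3_iff by auto
  show ?thesis
    by (rule exI[of _ "\<lambda>i. if i = 0 then a else if i = 1 then b else c"]) (use R abc in auto)
qed

text \<open>\<open>X\<close> has only \<open>t\<close> points, so every member of
  \<open>\<S>'\<close> must contain it; three of these form a star that forces \<open>X\<close> into
  the members of \<open>\<S>\<close>.\<close>

lemma kernel_star:
  assumes S: "\<And>A. A \<in> \<S> \<Longrightarrow> finite A \<and> card A \<le> t + 1"
    and S': "\<And>B. B \<in> \<S>' \<Longrightarrow> finite B \<and> card B = t + 1" and S'3: "card \<S>' \<ge> 3"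
    and cross: "cross_intersecting t \<S> \<S>'" and X: "X \<in> \<S>" "card X = t"
  shows "\<forall>A\<in>\<S> \<union> \<S>'. X \<subseteq> A"
proof -
  have finX: "finite X" using S X by simp
  have XB: "X \<subseteq> B" if B: "B \<in> \<S>'" for B
  proof -
    have "t \<le> card (X \<inter> B)" using cross X B by (simp add: cross_intersecting_def)
    then have "X \<inter> B = X" using finX X by (intro card_seteq) auto
    then show ?thesis by auto
  qed
  from ex_distinct_triple[OF S'3] obtain q :: "nat \<Rightarrow> nat set"
    where q': "\<forall>i. q i \<in> \<S>'" and q: "q 0 \<noteq> q 1" "q 0 \<noteq> q 2" "q 1 \<noteq> q 2" by (elim exE conjE)
  have "X \<subseteq> A" if A: "A \<in> \<S>" for A
  proof (rule superset_of_star[OF finX X(2) _ q])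
    show "finite (q i) \<and> card (q i) = t + 1 \<and> X \<subseteq> q i" for i
      using S' XB q' by simp
    show "card (A \<inter> q i) \<ge> t" for i
      using cross A q' by (simp add: cross_intersecting_def)
  qed (use S[OF A] in auto)
  then show ?thesis using XB by auto
qed

text \<open>Every member has \<open>t\<close> or \<open>t + 1\<close> points, since it meets a
  member of the other kernel in \<open>t\<close>. One \<open>t\<close>-set already fixes
  \<open>X\<close>; if there is none, two families of \<open>(t + 1)\<close>-sets remain. The bounds
  \<open>four\<close> are conditional because the count behind them applies to kernels of
  \<open>(t + 1)\<close>-sets. The bound on \<open>card \<S>\<close> in the conclusion later
  recovers \<open>Z\<close> as a union of two members.\<close>

lemma kernel_structure:
  assumes S: "\<And>A. A \<in> \<S> \<Longrightarrow> finite A \<and> card A \<le> t + 1"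
    and S': "\<And>A. A \<in> \<S>' \<Longrightarrow> finite A \<and> card A \<le> t + 1"
    and cross: "cross_intersecting t \<S> \<S>'" and ne: "\<S> \<noteq> {}" "\<S>' \<noteq> {}"
    and four: "(\<And>A. A \<in> \<S> \<Longrightarrow> card A = t + 1) \<Longrightarrow> card \<S> \<ge> 4"
      "(\<And>A. A \<in> \<S>' \<Longrightarrow> card A = t + 1) \<Longrightarrow> card \<S>' \<ge> 4"
  shows "(\<exists>X. finite X \<and> card X = t \<and> (\<forall>A\<in>\<S> \<union> \<S>'. X \<subseteq> A)) \<or>
    (\<exists>Z. finite Z \<and> card Z = t + 2 \<and> card \<S> \<ge> 4 \<and> (\<forall>A\<in>\<S> \<union> \<S>'. A \<subseteq> Z \<and> card A = t + 1))"
proof -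
  have cross': "cross_intersecting t \<S>' \<S>" using cross cross_intersecting_sym by simp
  have cr: "t \<le> card (A \<inter> B)" if "A \<in> \<S>" "B \<in> \<S>'" for A B
    using cross that by (simp add: cross_intersecting_def)
  have ge: "t \<le> card A" if "A \<in> \<S> \<union> \<S>'" for A
  proof (cases "A \<in> \<S>")
    case True
    obtain B where B: "B \<in> \<S>'" using ne by auto
    have "card (A \<inter> B) \<le> card A" using S[OF True] by (intro card_mono) auto
    then show ?thesis using cr[OF True B] by simp
  next
    case False
    then have A: "A \<in> \<S>'" using that by simp
    obtain B where B: "B \<in> \<S>" using ne by auto
    have "card (B \<inter> A) \<le> card A" using S'[OF A] by (intro card_mono) auto
    then show ?thesis using cr[OF B A] by simp
  qed
  have sz: "card A = t + 1" if "A \<in> \<S> \<union> \<S>'" "card A \<noteq> t" for A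
    using ge[OF that(1)] S[of A] S'[of A] that by force
  consider X X' where "X \<in> \<S>" "card X = t" "X' \<in> \<S>'" "card X' = t"
    | X where "X \<in> \<S>" "card X = t" "\<And>B. B \<in> \<S>' \<Longrightarrow> card B \<noteq> t"
    | X where "X \<in> \<S>'" "card X = t" "\<And>B. B \<in> \<S> \<Longrightarrow> card B \<noteq> t"
    | "\<And>B. B \<in> \<S> \<union> \<S>' \<Longrightarrow> card B \<noteq> t" by (metis Un_iff)
  then show ?thesis
  proof cases
    case 1
    have fin: "finite X" "finite X'" using 1 S S' by auto
    have XB: "X \<subseteq> B" if B: "B \<in> \<S>'" for B
    proof -
      have "X \<inter> B = X" using fin 1 cr[OF 1(1) B] by (intro card_seteq) auto
      then show ?thesis by auto
    qed
    have XA: "X' \<subseteq> A" if A: "A \<in> \<S>" for A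
    proof -
      have "A \<inter> X' = X'" using fin 1 cr[OF A 1(3)] by (intro card_seteq) auto
      then show ?thesis by auto
    qed
    have "X = X'" using XB[OF 1(3)] XA[OF 1(1)] by auto
    then have "\<forall>A\<in>\<S> \<union> \<S>'. X \<subseteq> A" using XA XB by auto
    then show ?thesis using fin 1 by (intro disjI1 exI[of _ X] conjI)
  next
    case 2
    have S'1: "finite B \<and> card B = t + 1" if "B \<in> \<S>'" for B using S'[OF that] sz 2(3) that by simp
    have "card \<S>' \<ge> 4" using four(2) S'1 by simp
    then have "\<forall>A\<in>\<S> \<union> \<S>'. X \<subseteq> A" using kernel_star[OF S S'1 _ cross 2(1,2)] by simp
    then show ?thesis using S 2 by (intro disjI1 exI[of _ X] conjI) simp_all
  next
    case 3
    have S1: "finite B \<and> card B = t + 1" if "B \<in> \<S>" for B using S[OF that] sz 3(3) that by simp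
    have "card \<S> \<ge> 4" using four(1) S1 by simp
    then have "\<forall>A\<in>\<S>' \<union> \<S>. X \<subseteq> A" using kernel_star[OF S' S1 _ cross' 3(1,2)] by simp
    then have "\<forall>A\<in>\<S> \<union> \<S>'. X \<subseteq> A" by (subst Un_commute)
    then show ?thesis using S' 3 by (intro disjI1 exI[of _ X] conjI) simp_all
  next
    case 4
    have c: "card A = t + 1" if "A \<in> \<S> \<union> \<S>'" for A using sz[OF that 4[OF that]] .
    then have S1: "\<And>A. A \<in> \<S> \<Longrightarrow> finite A \<and> card A = t + 1"
      and S'1: "\<And>A. A \<in> \<S>' \<Longrightarrow> finite A \<and> card A = t + 1" using S S' by auto
    have c4: "card \<S> \<ge> 4" "card \<S>' \<ge> 3" using four c by fastforce+
    have "(\<exists>X. finite X \<and> card X = t \<and> (\<forall>A\<in>\<S> \<union> \<S>'. X \<subseteq> A)) \<or>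
        (\<exists>Z. finite Z \<and> card Z = t + 2 \<and> (\<forall>A\<in>\<S> \<union> \<S>'. A \<subseteq> Z))"
      by (rule cross_intersecting_structure[OF S1 S'1 cross c4])
    then show ?thesis
    proof (elim disjE)
      assume "\<exists>Z. finite Z \<and> card Z = t + 2 \<and> (\<forall>A\<in>\<S> \<union> \<S>'. A \<subseteq> Z)"
      then show ?thesis using c c4 by (intro disjI2) simp
    qed (intro disjI1)
  qed
qed

section \<open>Numerical estimates\<close>

text \<open>By Pascal, raising the upper index from \<open>m - j\<close> to \<open>m\<close> adds
  \<open>j\<close> binomials with lower index \<open>w - 1\<close>, each at least the one at
  \<open>m - j\<close>.\<close>

lemma binomial_diff_ge: "(m choose w) \<ge> ((m - j) choose w) + j * ((m - j) choose (w - 1))"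
  if "j \<le> m" and "w > 0"
  using that
proof (induction j)
  case 0
  then show ?case by simp
next
  case (Suc j)
  have pas: "(m - j) choose w = ((m - Suc j) choose (w - 1)) + ((m - Suc j) choose w)"
    using choose_reduce_nat[of "m - j" w] Suc.prems by simp
  have "((m - Suc j) choose w) + Suc j * ((m - Suc j) choose (w - 1))
     = ((m - j) choose w) + j * ((m - Suc j) choose (w - 1))" using pas by simp
  also have "\<dots> \<le> ((m - j) choose w) + j * ((m - j) choose (w - 1))"
    by (intro add_left_mono mult_left_mono binomial_right_mono) auto
  also have "\<dots> \<le> m choose w" using Suc by simp
  finally show ?case .
qed

lemma e_gt_27: "exp 1 > (27/10 :: real)"
proof -
  \<comment> \<open>At 1 the quadratic Taylor bound gives only 5/2. At 1/8 it gives 1 + 1/8 + 1/128,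
    whose eighth power is large enough.\<close>
  have "(145/128::real) \<le> exp (1/8)"
    using exp_lower_Taylor_quadratic[of "1/8"] by (simp add: power2_eq_square)
  then have "(145/128::real) ^ 8 \<le> exp (1/8) ^ 8" by (intro power_mono) auto
  also have "\<dots> = exp (1::real)" by (simp add: exp_of_nat_mult[symmetric])
  finally have "(145/128::real) ^ 8 \<le> exp 1" .
  moreover have "(27/10::real) < (145/128) ^ 8" by (simp add: power_divide)
  ultimately show ?thesis by linarith
qed

text \<open>Here \<open>w = k - t\<close> and \<open>m = n - t\<close>. The number of \<open>k\<close>-subsets of \<open>[n]\<close> containing a fixed
  \<open>(t + q)\<close>-set is at most \<open>p^(q - 1) N\<close> for \<open>q \<ge> 1\<close>, with equality for \<open>q = 1\<close>, and \<open>h\<close> below counts those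
  containing a fixed \<open>t\<close>-set and meeting a fixed \<open>(w + 1)\<close>-set disjoint from it. In units of \<open>N\<close>, peeling
  off the sets of size \<open>t + q\<close> costs \<open>T q\<close>, and \<open>E\<close> is the total cost.\<close>

locale large_n =
  fixes n k t w m :: nat
  assumes k_eq: "k = t + w" and n_eq: "n = t + m" and t_ge: "t \<ge> 2" and w_ge: "w \<ge> 2"
    and m_ge_t: "30 * (t + 2) * w \<le> m"
    and m_ge_e: "2 * exp 1 * real k * real w \<le> real m"
begin

definition p :: real where "p = real w / real m"
definition N :: real where "N = real ((m - 1) choose (w - 1))"

lemma m_ge: "m \<ge> 120 * w"
proof -
  have "120 * w \<le> 30 * (t + 2) * w" using t_ge by (intro mult_right_mono) auto
  then show ?thesis using m_ge_t by linarith
qed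

lemma m_gt: "m > w + 1" using m_ge w_ge by linarith

lemma p_pos: "p > 0" using w_ge m_gt by (simp add: p_def)

lemma N_ge: "N \<ge> 1"
proof -
  have "(m - 1) choose (w - 1) > 0" using m_gt by (intro zero_less_binomial) auto
  then show ?thesis unfolding N_def by linarith
qed

lemma p_le_t: "30 * (real t + 2) * p \<le> 1"
proof -
  have "real (30 * (t + 2) * w) \<le> real m" using m_ge_t by (rule of_nat_mono)
  then show ?thesis using m_gt by (simp add: p_def field_simps)
qed

lemma p_le_e: "2 * exp 1 * real k * p \<le> 1"
  using m_ge_e m_gt by (simp add: p_def field_simps)

text \<open>The rational form of \<open>p_le_e\<close>, using e > 27/10. It is the source of the
  constants 5/27 and 22/27 = 1 - 5/27 below.\<close>

lemma p_le_k: "27 * real k * p \<le> 5"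
proof -
  have "27/10 * (2 * real k * p) \<le> exp 1 * (2 * real k * p)"
    using e_gt_27 p_pos by (intro mult_right_mono) auto
  then show ?thesis using p_le_e by simp
qed

lemma p_le_w: "27 * (real w + 2) * p \<le> 5"
proof -
  have "27 * (real w + 2) * p \<le> 27 * real k * p"
    using k_eq t_ge p_pos by (intro mult_right_mono mult_left_mono) auto
  then show ?thesis using p_le_k by linarith
qed

text \<open>By absorption, consecutive terms have ratio \<open>(w - q) / (m - q)\<close>, which is
  at most \<open>w / m = p\<close>.\<close>

lemma binomial_decay:
  assumes "1 \<le> q" and "q \<le> w"
  shows "real ((m - q) choose (w - q)) \<le> p ^ (q - 1) * N"
  using assms
proof (induction q rule: dec_induct)
  case base
  then show ?case by (simp add: N_def)
next
  case (step q)
  have q: "q < w" "w \<le> m" using step m_gt by auto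
  have "(w - q) * ((m - q) choose (w - q)) = (m - q) * ((m - Suc q) choose (w - Suc q))"
    using binomial_absorption[of "w - Suc q" "m - q"] q by (simp add: Suc_diff_Suc)
  then have eq: "real (w - q) * real ((m - q) choose (w - q))
      = real (m - q) * real ((m - Suc q) choose (w - Suc q))"
    by (metis of_nat_mult)
  have "real (w - q) \<le> p * real (m - q)"
  proof -
    have "real q * real w \<le> real q * real m" using q by (intro mult_left_mono) auto
    then show ?thesis using q by (simp add: p_def of_nat_diff field_simps)
  qed
  then have "real (w - q) * real ((m - q) choose (w - q))
      \<le> p * real (m - q) * real ((m - q) choose (w - q))"
    by (intro mult_right_mono) auto
  then have "real (m - q) * real ((m - Suc q) choose (w - Suc q))
      \<le> real (m - q) * (p * real ((m - q) choose (w - q)))"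
    using eq by (simp add: mult_ac)
  then have "real ((m - Suc q) choose (w - Suc q)) \<le> p * real ((m - q) choose (w - q))"
    using q by (simp add: mult_le_cancel_left)
  also have "\<dots> \<le> p * (p ^ (q - 1) * N)"
    using step p_pos by (intro mult_left_mono) auto
  also have "\<dots> = p ^ (Suc q - 1) * N" using step by (cases q) auto
  finally show ?case .
qed

lemma binomial_decay_2: "real ((m - 2) choose (w - 2)) \<le> p * N"
  using binomial_decay[of 2] w_ge by simp

text \<open>Each unit taken off the upper index removes, by Pascal, a binomial of at most
  \<open>(m - 2) choose (w - 2)\<close>, hence at most \<open>p * N\<close>.\<close>

lemma binomial_shift: "real ((m - 1 - j) choose (w - 1)) \<ge> (1 - real j * p) * N"
proof (induction j)
  case 0
  then show ?case by (simp add: N_def)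
next
  case (Suc j)
  have pN: "p * N \<ge> 0" using p_pos N_ge by simp
  show ?case
  proof (cases "m - 1 - j = 0")
    \<comment> \<open>Truncated subtraction: the upper index stays at 0 and nothing is lost.\<close>
    case True
    then have "real ((m - 1 - Suc j) choose (w - 1)) = real ((m - 1 - j) choose (w - 1))" by simp
    then show ?thesis using Suc pN by (simp add: algebra_simps)
  next
    case False
    have "(m - 1 - j) choose (w - 1)
        = ((m - 1 - Suc j) choose (w - 2)) + ((m - 1 - Suc j) choose (w - 1))"
      using choose_reduce_nat[of "m - 1 - j" "w - 1"] False w_ge by (simp add: numeral_2_eq_2)
    then have "real ((m - 1 - j) choose (w - 1))
        = real ((m - 1 - Suc j) choose (w - 2)) + real ((m - 1 - Suc j) choose (w - 1))"
      by (metis of_nat_add)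
    moreover have "real ((m - 1 - Suc j) choose (w - 2)) \<le> real ((m - 2) choose (w - 2))"
      by (intro of_nat_mono binomial_right_mono) auto
    ultimately show ?thesis using Suc binomial_decay_2 by (simp add: algebra_simps)
  qed
qed

definition h :: nat where "h = (m choose w) - ((m - (w + 1)) choose w)"

text \<open>The difference telescopes into \<open>w + 1\<close> terms, the smallest of which keeps
  the fraction \<open>1 - w p \<ge> 22/27\<close> of \<open>N\<close>.\<close>

lemma h_ge: "real h \<ge> 22/27 * (real w + 1) * N"
proof -
  have "((m - (w + 1)) choose w) + (w + 1) * ((m - (w + 1)) choose (w - 1)) \<le> m choose w"
    using binomial_diff_ge[of "w + 1" m w] m_gt w_ge by linarith
  then have "(w + 1) * ((m - (w + 1)) choose (w - 1)) \<le> h" unfolding h_def by linarith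
  then have "real (w + 1) * real ((m - 1 - w) choose (w - 1)) \<le> real h"
    by (metis of_nat_mult of_nat_mono diff_diff_left add.commute)
  moreover have "real (w + 1) * (22/27 * N) \<le> real (w + 1) * real ((m - 1 - w) choose (w - 1))"
  proof (intro mult_left_mono)
    have "27 * real w * p \<le> 5" using p_le_w p_pos by (simp add: algebra_simps)
    then have "22/27 * N \<le> (1 - real w * p) * N" using N_ge by (intro mult_right_mono) auto
    then show "22/27 * N \<le> real ((m - 1 - w) choose (w - 1))"
      using binomial_shift[of w] by linarith
  qed auto
  ultimately show ?thesis by (simp add: algebra_simps)
qed

section \<open>Cost of the peeling\<close>

definition T :: "nat \<Rightarrow> real" where
  "T q = real ((t + q) choose t) * (real q + 1) ^ q * p ^ (q - 1)"

lemma T_nonneg: "T q \<ge> 0" using p_pos by (simp add: T_def)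

text \<open>The ratio of the two costs is
  \<open>(t + q + 1) p ((q + 2) / (q + 1)) ^ (q + 1)\<close>. The power is at most e and
  \<open>t + q + 1 \<le> k\<close>, so \<open>p_le_e\<close> bounds the ratio by 1/2.\<close>

lemma T_Suc: assumes "q \<ge> 2" and "q < w" shows "2 * T (Suc q) \<le> T q"
proof -
  have "Suc q * ((t + Suc q) choose t) = Suc (t + q) * ((t + q) choose t)"
  proof -
    have "(t + Suc q) choose t = Suc (t + q) choose Suc q"
      using binomial_symmetric[of t "t + Suc q"] by simp
    moreover have "(t + q) choose t = (t + q) choose q"
      using binomial_symmetric[of t "t + q"] by simp
    ultimately show ?thesis using Suc_times_binomial_eq[of "t + q" q] by (simp add: mult.commute)
  qed
  then have "real (Suc q) * real ((t + Suc q) choose t) = real (Suc (t + q)) * real ((t + q) choose t)"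
    by (metis of_nat_mult)
  then have bin: "real ((t + Suc q) choose t) * (real q + 1) = real (Suc (t + q)) * real ((t + q) choose t)"
    by (simp add: mult.commute add.commute)
  have "(1 + 1 / real (Suc q)) ^ Suc q \<le> exp (1 / real (Suc q)) ^ Suc q"
    by (intro power_mono exp_ge_add_one_self) auto
  also have "\<dots> = exp 1" by (simp add: exp_of_nat_mult[symmetric] del: of_nat_Suc power_Suc)
  finally have "(1 + 1 / real (Suc q)) ^ Suc q \<le> exp 1" .
  then have "(real q + 1) ^ Suc q * (1 + 1 / real (Suc q)) ^ Suc q \<le> (real q + 1) ^ Suc q * exp 1"
    by (intro mult_left_mono) auto
  also have "(real q + 1) ^ Suc q * (1 + 1 / real (Suc q)) ^ Suc q = (real (Suc q) + 1) ^ Suc q"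
  proof -
    have "(real q + 1) * (1 + 1 / real (Suc q)) = real (Suc q) + 1" by (simp add: field_simps)
    then show ?thesis by (simp only: power_mult_distrib[symmetric])
  qed
  finally have pw: "(real (Suc q) + 1) ^ Suc q \<le> (real q + 1) ^ Suc q * exp 1" .
  have "T (Suc q) = real ((t + Suc q) choose t) * p ^ q * (real (Suc q) + 1) ^ Suc q"
    by (simp add: T_def mult_ac)
  also have "\<dots> \<le> real ((t + Suc q) choose t) * p ^ q * ((real q + 1) ^ Suc q * exp 1)"
    using p_pos by (intro mult_left_mono pw) auto
  also have "\<dots> = (real ((t + Suc q) choose t) * (real q + 1)) * (real q + 1) ^ q * p ^ q * exp 1"
    by (simp add: mult_ac)
  also have "\<dots> = real (Suc (t + q)) * real ((t + q) choose t) * (real q + 1) ^ q * p ^ q * exp 1"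
    unfolding bin by simp
  also have "\<dots> = T q * (exp 1 * real (Suc (t + q)) * p)"
  proof -
    have "p ^ q = p ^ (q - 1) * p" using assms by (cases q) (auto simp: mult.commute)
    then show ?thesis by (simp add: T_def mult_ac)
  qed
  also have "\<dots> \<le> T q * (1/2)"
  proof (intro mult_left_mono T_nonneg)
    have "exp 1 * real (Suc (t + q)) * p \<le> exp 1 * real k * p"
      using assms p_pos k_eq by (intro mult_right_mono mult_left_mono) auto
    then show "exp 1 * real (Suc (t + q)) * p \<le> 1/2" using p_le_e by linarith
  qed
  finally show ?thesis by simp
qed

lemma choose_two_real: "real ((t + 2) choose 2) = (real t + 2) * (real t + 1) / 2"
proof -
  have "2 * ((t + 2) choose 2) = (t + 2) * (t + 1)"
    using binomial_absorption[of 1 "t + 2"] by (simp add: numeral_2_eq_2)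
  then have "real 2 * real ((t + 2) choose 2) = real (t + 2) * real (t + 1)" by (metis of_nat_mult)
  moreover have "real (t + 2) * real (t + 1) = (real t + 2) * (real t + 1)"
    by (simp only: of_nat_add of_nat_numeral of_nat_1)
  ultimately show ?thesis by linarith
qed

lemma T_2: "T 2 \<le> 3/20 * (real t + 1)"
proof -
  have "(t + 2) choose t = (t + 2) choose 2" using binomial_symmetric[of t "t + 2"] by simp
  also have "real \<dots> = (real t + 2) * (real t + 1) / 2"
    by (rule choose_two_real)
  finally have "real ((t + 2) choose t) = (real t + 2) * (real t + 1) / 2" .
  then have "T 2 = (real t + 2) * (real t + 1) / 2 * (real 2 + 1) ^ 2 * p ^ (2 - 1)"
    unfolding T_def by (simp only:)
  then have "T 2 = 9/60 * (real t + 1) * (30 * (real t + 2) * p)"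
    by (simp add: field_simps)
  also have "\<dots> \<le> 9/60 * (real t + 1) * 1" by (intro mult_left_mono p_le_t) auto
  finally show ?thesis by simp
qed

text \<open>Halving \<open>T 2\<close> would give too weak a tail for the total loss to stay below
  18/100 of the threshold. Here \<open>(t + 3) (t + 1) \<le> (t + 2)^2\<close> lets
  \<open>p^2\<close> contribute a factor 1/900.\<close>

lemma T_3: "T 3 \<le> 3/250 * (real t + 2)"
proof -
  have "3 * ((t + 3) choose 3) = (t + 3) * ((t + 2) choose 2)"
    using binomial_absorption[of 2 "t + 3"] by (simp add: numeral_3_eq_3)
  then have "3 * real ((t + 3) choose 3) = (real t + 3) * real ((t + 2) choose 2)"
    by (metis (mono_tags, lifting) of_nat_mult of_nat_add of_nat_numeral)
  moreover have "real ((t + 2) choose 2) = (real t + 2) * (real t + 1) / 2"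
    by (rule choose_two_real)
  moreover have "(t + 3) choose t = (t + 3) choose 3"
    using binomial_symmetric[of t "t + 3"] by simp
  ultimately have "real ((t + 3) choose t) = (real t + 3) * ((real t + 2) * (real t + 1) / 2) / 3"
    by (metis nonzero_mult_div_cancel_left zero_neq_numeral)
  then have "T 3 = (real t + 3) * ((real t + 2) * (real t + 1) / 2) / 3 * (real 3 + 1) ^ 3 * p ^ (3 - 1)"
    unfolding T_def by (simp only:)
  then have "T 3 = 64/6 * (real t + 2) * (((real t + 3) * (real t + 1)) * p ^ 2)" by simp
  also have "\<dots> \<le> 64/6 * (real t + 2) * (1/900)"
  proof (intro mult_left_mono)
    have "(real t + 3) * (real t + 1) * p\<^sup>2 \<le> (real t + 2)\<^sup>2 * p\<^sup>2"
      by (intro mult_right_mono) (auto simp: power2_eq_square algebra_simps)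
    also have "\<dots> = ((30 * (real t + 2) * p) ^ 2) / 900" by (simp only: power_mult_distrib) simp
    also have "\<dots> \<le> 1 ^ 2 / 900"
      using p_le_t p_pos by (intro divide_right_mono power_mono) auto
    finally show "(real t + 3) * (real t + 1) * p\<^sup>2 \<le> 1/900" by simp
  qed auto
  also have "\<dots> \<le> 3/250 * (real t + 2)" by simp
  finally show ?thesis .
qed

definition E :: real where "E = (\<Sum>q=2..w. T q)"

lemma E_le: "E \<le> 3/20 * (real t + 1) + 3/125 * (real t + 2)"
proof (cases "w = 2")
  case True
  have "E = sum T {2}" unfolding E_def by (rule sum.cong) (use True in auto)
  then have "E = T 2" by simp
  then show ?thesis using T_2 by (simp add: field_simps)
next
  case False
  \<comment> \<open>The second copy of \<open>T j\<close> carries the geometric tail through the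
    induction: it pays for two copies of \<open>T (Suc j)\<close>.\<close>
  have "j \<le> w \<Longrightarrow> (\<Sum>q=3..j. T q) + T j \<le> 2 * T 3" if "j \<ge> 3" for j
    using that
  proof (induction j rule: dec_induct)
    case base
    then show ?case by simp
  next
    case (step j)
    have "2 * T (Suc j) \<le> T j" using step by (intro T_Suc) auto
    then show ?case using step by simp
  qed
  from this[of w] have "(\<Sum>q=3..w. T q) + T w \<le> 2 * T 3" using False w_ge by simp
  moreover have "E = T 2 + (\<Sum>q=3..w. T q)"
    unfolding E_def using w_ge by (subst sum.atLeast_Suc_atMost) (auto simp: numeral_3_eq_3)
  ultimately show ?thesis using T_2 T_3 T_nonneg[of w] by argo
qed

text \<open>\<open>M\<close> will be the size of \<F> or \<G>, and \<open>M - E * N\<close> a lower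
  bound for the part its kernel generates. The first bound yields kernels of at least four sets, the
  second beats \<open>card_near_famA\<close>, the third beats \<open>card_star_deep\<close>; the
  first and third together exclude small covers in \<open>card_near_star\<close>.\<close>

lemma threshold_bounds:
  assumes A: "M \<ge> (real t + 2) * N - (real t + 1) * p * N" and H: "M \<ge> real h"
  shows "M - E * N > 3 * N" and "M - E * N > 2 * N + 5/27 * real t * N"
    and "M - E * N > 3/5 * (real w + 1) * N"
proof -
  have "(real t + 1) * p \<le> 1/30" using p_le_t p_pos by (simp add: algebra_simps)
  then have "(real t + 2 - 1/30) * N \<le> (real t + 2 - (real t + 1) * p) * N"
    using N_ge by (intro mult_right_mono) auto
  then have M: "real t * N + 59/30 * N \<le> M" using A by (simp add: algebra_simps)
  have "E * N \<le> (3/20 * (real t + 1) + 3/125 * (real t + 2)) * N"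
    using E_le N_ge by (intro mult_right_mono) auto
  also have "\<dots> = 174/1000 * (real t * N) + 198/1000 * N" by (simp add: field_simps)
  finally have EN: "E * N \<le> 174/1000 * (real t * N) + 198/1000 * N" .
  have tN: "2 * N \<le> real t * N" using t_ge N_ge by (intro mult_right_mono) auto
  show "M - E * N > 3 * N" using M EN tN N_ge by linarith
  show "M - E * N > 2 * N + 5/27 * real t * N"
    using M EN tN N_ge unfolding mult.assoc by linarith
  \<comment> \<open>Enough because 82/100 * 22/27 > 3/5.\<close>
  have "E * N \<le> 18/100 * M" using M EN tN N_ge by linarith
  moreover have "22/27 * (real w * N) + 22/27 * N \<le> M"
    using h_ge H by (simp add: algebra_simps)
  moreover have "real w * N \<ge> 0" using N_ge by simp
  moreover have "3/5 * (real w + 1) * N = 3/5 * (real w * N) + 3/5 * N" by (simp add: algebra_simps)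
  ultimately show "M - E * N > 3/5 * (real w + 1) * N" using N_ge by linarith
qed

text \<open>A star with more than \<open>3 N\<close> and more than \<open>3/5 (w + 1) N\<close>
  members must have no cover of \<open>s\<close> points, which caps \<open>s\<close>; yet
  \<open>s\<close> must be large enough for the powers of 5/27 to beat \<open>w ^ 3\<close>. The
  constant 24 has little room: \<open>w = 5\<close>, \<open>s = 3\<close> gives 625/27, and 24/30
  must stay below 22/27.\<close>

lemma cover_number_exponent:
  obtains s where "2 \<le> s" "s \<le> w" "s \<le> 3 \<or> 5 * s \<le> 3 * (w + 1)"
    "real w ^ 3 * (5/27) ^ (s - 2) < 24"
proof -
  have big: "(5/3 * real s + 1/3) ^ 3 * (5/27) ^ (s - 2) < 24" if "s \<ge> 4" for s
    using that
  proof (induction s rule: dec_induct)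
    case base
    then show ?case by (simp add: power_divide)
  next
    case (step s)
    have "real s \<ge> 4" using step by simp
    \<comment> \<open>Per step the cube grows by at most (5/3)^3 = 125/27, and the extra factor 5/27
      turns this into 625/729 < 1.\<close>
    then have "5/3 * real (Suc s) + 1/3 \<le> 5/3 * (5/3 * real s + 1/3)"
      unfolding of_nat_Suc distrib_left by linarith
    then have "(5/3 * real (Suc s) + 1/3) ^ 3 \<le> (5/3 * (5/3 * real s + 1/3)) ^ 3"
      by (intro power_mono) auto
    also have "\<dots> = 125/27 * (5/3 * real s + 1/3) ^ 3"
      by (subst power_mult_distrib) (simp add: power_divide)
    finally have "(5/3 * real (Suc s) + 1/3) ^ 3 * (5/27) ^ (Suc s - 2)
        \<le> 125/27 * (5/3 * real s + 1/3) ^ 3 * (5/27) ^ (Suc s - 2)"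
      by (intro mult_right_mono) auto
    also have "\<dots> = (625/729) * ((5/3 * real s + 1/3) ^ 3 * (5/27) ^ (s - 2))"
    proof -
      have "Suc s - 2 = Suc (s - 2)" using step by simp
      then show ?thesis by simp
    qed
    also have "\<dots> \<le> 1 * ((5/3 * real s + 1/3) ^ 3 * (5/27) ^ (s - 2))"
      by (intro mult_right_mono) auto
    finally show ?case using step by simp
  qed
  consider "w = 2" | "w \<in> {3, 4, 5}" | "w \<ge> 6" using w_ge by fastforce
  then show thesis
  proof cases
    case 1
    then show thesis using that[of 2] by simp
  next
    case 2
    then show thesis using that[of 3] by auto
  next
    case 3
    \<comment> \<open>The largest \<open>s\<close> with
      \<open>5 * s \<le> 3 * (w + 1)\<close>.\<close>
    define s where "s = (3 * w + 3) div 5"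
    have s: "s \<ge> 4" "5 * s \<le> 3 * (w + 1)" "3 * w \<le> 5 * s + 1" using 3 by (auto simp: s_def)
    have "real (3 * w) \<le> real (5 * s + 1)" using s(3) by (rule of_nat_mono)
    then have "real w \<le> 5/3 * real s + 1/3" by simp
    then have "real w ^ 3 \<le> (5/3 * real s + 1/3) ^ 3" by (intro power_mono) auto
    then have "real w ^ 3 * (5/27) ^ (s - 2) \<le> (5/3 * real s + 1/3) ^ 3 * (5/27) ^ (s - 2)"
      by (intro mult_right_mono) auto
    from le_less_trans[OF this big[OF s(1)]] show thesis
      by (rule that[of s, rotated 3]) (use s 3 in simp_all)
  qed
qed

end

section \<open>Peeling\<close>

definition uncovered :: "nat set set \<Rightarrow> nat set set \<Rightarrow> nat set set" where
  "uncovered \<F> \<S> = {F \<in> \<F>. \<forall>A\<in>\<S>. \<not> A \<subseteq> F}"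

text \<open>Single deletions suffice as a test: every proper subset of \<open>A\<close> lies in some
  \<open>A - {x}\<close>.\<close>

definition irreducible_wrt :: "nat \<Rightarrow> nat set set \<Rightarrow> nat set set \<Rightarrow> bool" where
  "irreducible_wrt t \<S> \<S>' \<longleftrightarrow> (\<forall>A\<in>\<S>. \<forall>x\<in>A. \<exists>B\<in>\<S>'. card ((A - {x}) \<inter> B) < t)"

text \<open>Each top-size \<open>A\<close> contains one of the \<open>t\<close>-subsets of a fixed
  \<open>B0\<close>. From there, a smaller \<open>T\<close> inside some \<open>A\<close> misses a
  point \<open>x\<close> of it, irreducibility gives a \<open>B\<close> sharing fewer than
  \<open>t\<close> points with \<open>A - {x}\<close>, hence with \<open>T\<close>, and
  \<open>meeting_set\<close> offers at most \<open>r + 1\<close> extensions. After \<open>r\<close>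
  of them \<open>A\<close> itself is reached, so no factor depends on the ground set.\<close>

lemma card_top_layer:
  assumes V: "finite V" and r: "r \<ge> 1"
    and S: "\<And>A. A \<in> \<S> \<Longrightarrow> A \<subseteq> V" and S': "\<And>B. B \<in> \<S>' \<Longrightarrow> B \<subseteq> V \<and> card B \<le> t + r"
    and cross: "cross_intersecting t \<S> \<S>'" and irr: "irreducible_wrt t \<S> \<S>'"
  shows "card {A \<in> \<S>. card A = t + r} \<le> ((t + r) choose t) * (r + 1) ^ r"
proof (cases "{A \<in> \<S>. card A = t + r} = {}")
  case True
  then show ?thesis by (simp only: card.empty zero_le)
next
  case False
  define W where "W = {A \<in> \<S>. card A = t + r}"
  have WS: "A \<in> \<S>" "card A = t + r" if "A \<in> W" for A using that by (auto simp: W_def)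
  have finV: "finite A" if "A \<subseteq> V" for A using finite_subset[OF that V] .
  have W: "W \<subseteq> nsets V (t + r)"
    using S finV by (auto simp: W_def nsets_def)
  obtain A0 where A0: "A0 \<in> W" using False by (auto simp: W_def)
  have "A0 \<noteq> {}" using WS(2)[OF A0] r by auto
  then obtain x0 where x0: "x0 \<in> A0" by auto
  then have "\<S>' \<noteq> {}" using irr WS(1)[OF A0] by (auto simp: irreducible_wrt_def)
  then obtain B0 where B0: "B0 \<in> \<S>'" by auto
  then have fB0: "finite B0" "card B0 \<le> t + r" using S' finV by auto
  let ?Y = "{Y. Y \<subseteq> B0 \<and> card Y = t}"
  have finY: "finite ?Y" using fB0 by simp
  have branch: "card {A \<in> W. Y \<subseteq> A} \<le> (r + 1) ^ r" if Y: "Y \<in> ?Y" for Y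
  proof -
    have "card {A \<in> W. Y \<subseteq> A} \<le> (r + 1) ^ (t + r - card Y) * ((card V - (t + r)) choose (t + r - (t + r)))"
    proof (rule card_branching[OF V W])
      fix T assume T: "Y \<subseteq> T" "T \<subseteq> V" "card T < t + r"
      show "\<exists>C. finite C \<and> card C \<le> r + 1 \<and> C \<inter> T = {} \<and> (\<forall>A\<in>W. T \<subseteq> A \<longrightarrow> A \<inter> C \<noteq> {})"
      proof (cases "\<exists>A\<in>W. T \<subseteq> A")
        case False
        then show ?thesis by (intro exI[of _ "{}"]) auto
      next
        case True
        then obtain A where A: "A \<in> W" "T \<subseteq> A" by blast
        have "T \<noteq> A" using WS(2)[OF A(1)] T(3) by auto
        then obtain x where x: "x \<in> A" "x \<notin> T" using A(2) by auto
        then obtain B where B: "B \<in> \<S>'" "card ((A - {x}) \<inter> B) < t"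
          using irr WS(1)[OF A(1)] by (auto simp: irreducible_wrt_def)
        have fB: "finite B" "card B \<le> t + r" using S'[OF B(1)] finV by auto
        have "card (T \<inter> B) \<le> card ((A - {x}) \<inter> B)"
          using A x fB by (intro card_mono) auto
        then have "card (T \<inter> B) < t" using B by simp
        from meeting_set[OF fB this] obtain D where D: "finite D" "card D \<le> r + 1" "D \<subseteq> B - T"
          "\<forall>A. card (A \<inter> B) \<ge> t \<longrightarrow> A \<inter> D \<noteq> {}"
          by (elim exE conjE)
        have "\<forall>A\<in>W. T \<subseteq> A \<longrightarrow> A \<inter> D \<noteq> {}"
          using D(4) cross B(1) WS(1) by (simp add: cross_intersecting_def)
        moreover have "D \<inter> T = {}" using D(3) by auto
        ultimately show ?thesis using D(1,2) by (intro exI[of _ D] conjI)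
      qed
    qed (use Y S'[OF B0] in auto)
    then show ?thesis using Y by simp
  qed
  have "card W \<le> card (\<Union>Y\<in>?Y. {A \<in> W. Y \<subseteq> A})"
  proof (rule card_mono)
    show "finite (\<Union>Y\<in>?Y. {A \<in> W. Y \<subseteq> A})" using finY finite_nsets_sub[OF V W] by auto
    show "W \<subseteq> (\<Union>Y\<in>?Y. {A \<in> W. Y \<subseteq> A})"
    proof
      fix A assume A: "A \<in> W"
      then have "t \<le> card (A \<inter> B0)" using cross B0 WS(1) by (simp add: cross_intersecting_def)
      then obtain Y where "Y \<subseteq> A \<inter> B0" "card Y = t" by (meson obtain_subset_with_card_n)
      then show "A \<in> (\<Union>Y\<in>?Y. {A \<in> W. Y \<subseteq> A})" using A by auto
    qed
  qed
  also have "\<dots> \<le> (\<Sum>Y\<in>?Y. card {A \<in> W. Y \<subseteq> A})" by (rule card_UN_le[OF finY])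
  also have "\<dots> \<le> (\<Sum>Y\<in>?Y. (r + 1) ^ r)" using branch by (intro sum_mono)
  also have "\<dots> = (card B0 choose t) * (r + 1) ^ r" using n_subsets[OF fB0(1)] by simp
  also have "\<dots> \<le> ((t + r) choose t) * (r + 1) ^ r"
    using fB0 by (intro mult_right_mono binomial_right_mono) auto
  finally show ?thesis by (simp add: W_def)
qed

section \<open>Shrinking to an irreducible pair\<close>

lemma card_filter_mono:
  "finite B \<Longrightarrow> A \<subseteq> B \<Longrightarrow> card {x \<in> A. Q x} \<le> card {x \<in> B. Q x}"
  by (intro card_mono) auto

text \<open>The measure drops even if \<open>A - {x}\<close> is already a member, since the two then
  merge.\<close>

lemma sum_card_shrink:
  assumes "finite \<S>" and "A \<in> \<S>" and "finite A" and "x \<in> A"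
  shows "sum card (insert (A - {x}) (\<S> - {A})) < sum card \<S>"
proof -
  have "sum card (insert (A - {x}) (\<S> - {A})) \<le> card (A - {x}) + sum card (\<S> - {A})"
    using assms by (cases "A - {x} \<in> \<S> - {A}") (simp_all add: insert_absorb del: card_Diff_insert)
  also have "\<dots> < card A + sum card (\<S> - {A})" 
    using assms by (simp add: card_Diff1_less del: card_Diff_insert)
  also have "\<dots> = sum card \<S>" using assms by (simp add: sum.remove)
  finally show ?thesis .
qed

definition approximates ::
  "nat set \<Rightarrow> nat \<Rightarrow> nat \<Rightarrow> real \<Rightarrow> nat set set \<Rightarrow> nat set set \<Rightarrow> nat set set \<times> nat set set \<Rightarrow> bool"
  where "approximates V t b \<epsilon> \<F> \<G> P \<longleftrightarrow>
    (\<forall>A\<in>fst P \<union> snd P. A \<subseteq> V \<and> card A \<le> b) \<and> cross_intersecting t (fst P) (snd P) \<and>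
    real (card (uncovered \<F> (fst P))) \<le> \<epsilon> \<and> real (card (uncovered \<G> (snd P))) \<le> \<epsilon>"

lemma approximates_swap: "approximates V t b \<epsilon> \<F> \<G> (\<S>, \<S>') \<longleftrightarrow> approximates V t b \<epsilon> \<G> \<F> (\<S>', \<S>)"
  unfolding approximates_def using cross_intersecting_sym[of t \<S> \<S>'] by auto

text \<open>Failure of irreducibility at \<open>x\<close> is exactly the cross condition for
  \<open>A - {x}\<close>, and whatever contained \<open>A\<close> contains \<open>A - {x}\<close>,
  so nothing becomes uncovered.\<close>

lemma approximates_shrink:
  assumes V: "finite V" and fin: "finite \<F>" and P: "approximates V t b \<epsilon> \<F> \<G> (\<S>, \<S>')"
    and A: "A \<in> \<S>" "x \<in> A" and x: "\<not> (\<exists>B\<in>\<S>'. card ((A - {x}) \<inter> B) < t)"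
  shows "approximates V t b \<epsilon> \<F> \<G> (insert (A - {x}) (\<S> - {A}), \<S>')"
proof -
  have AV: "A \<subseteq> V" "card A \<le> b" using P A by (auto simp: approximates_def)
  then have finA: "finite A" using finite_subset V by blast
  have "card (A - {x}) \<le> card A" using finA by (intro card_mono) auto
  moreover have "cross_intersecting t (insert (A - {x}) (\<S> - {A})) \<S>'"
    using P x unfolding approximates_def cross_intersecting_def by (auto simp: not_less)
  moreover have "uncovered \<F> (insert (A - {x}) (\<S> - {A})) \<subseteq> uncovered \<F> \<S>"
  proof
    fix F assume F: "F \<in> uncovered \<F> (insert (A - {x}) (\<S> - {A}))"
    then have F1: "F \<in> \<F>" "\<not> A - {x} \<subseteq> F" "\<And>C. C \<in> \<S> \<Longrightarrow> C \<noteq> A \<Longrightarrow> \<not> C \<subseteq> F"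
      by (auto simp: uncovered_def)
    then have "\<not> A \<subseteq> F" by auto
    then show "F \<in> uncovered \<F> \<S>" using F1 by (auto simp: uncovered_def)
  qed
  then have "card (uncovered \<F> (insert (A - {x}) (\<S> - {A}))) \<le> card (uncovered \<F> \<S>)"
    using fin by (intro card_mono) (auto simp: uncovered_def)
  ultimately show ?thesis using P AV unfolding approximates_def by auto
qed

text \<open>Instead of iterating, take an approximating pair of least total size; by
  \<open>sum_card_shrink\<close> it cannot be shrunk further.\<close>

lemma approximates_irreducible:
  assumes V: "finite V" and fin: "finite \<F>" "finite \<G>" and P: "approximates V t b \<epsilon> \<F> \<G> P"
  obtains \<S> \<S>' where "approximates V t b \<epsilon> \<F> \<G> (\<S>, \<S>')"
    "irreducible_wrt t \<S> \<S>'" "irreducible_wrt t \<S>' \<S>"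
proof -
  define \<mu> where "\<mu> = (\<lambda>P :: nat set set \<times> nat set set. sum card (fst P) + sum card (snd P))"
  obtain Q where Q: "approximates V t b \<epsilon> \<F> \<G> Q"
    and min: "\<And>R. approximates V t b \<epsilon> \<F> \<G> R \<Longrightarrow> \<mu> Q \<le> \<mu> R"
    using ex_has_least_nat[of "approximates V t b \<epsilon> \<F> \<G>" P \<mu>] P by metis
  obtain \<S> \<S>' where SS: "Q = (\<S>, \<S>')" by (cases Q)
  have sub: "A \<subseteq> V" if "A \<in> \<S> \<or> A \<in> \<S>'" for A using Q that by (auto simp: SS approximates_def)
  have "\<S> \<subseteq> Pow V" "\<S>' \<subseteq> Pow V" using sub by auto
  then have finS: "finite \<S>" "finite \<S>'" using V by (meson finite_Pow_iff finite_subset)+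
  have finA: "finite A" if "A \<in> \<S> \<or> A \<in> \<S>'" for A using sub[OF that] V by (rule finite_subset)
  have "irreducible_wrt t \<S> \<S>'" unfolding irreducible_wrt_def
  proof (intro ballI)
    fix A x assume A: "A \<in> \<S>" "x \<in> A"
    show "\<exists>B\<in>\<S>'. card ((A - {x}) \<inter> B) < t"
    proof (rule ccontr)
      assume no: "\<not> (\<exists>B\<in>\<S>'. card ((A - {x}) \<inter> B) < t)"
      from min[OF approximates_shrink[OF V fin(1) Q[unfolded SS] A no]]
      show False using sum_card_shrink[OF finS(1) A(1) _ A(2)] finA A(1)
        by (simp add: \<mu>_def SS)
    qed
  qed
  moreover have "irreducible_wrt t \<S>' \<S>" unfolding irreducible_wrt_def
  proof (intro ballI)
    fix A x assume A: "A \<in> \<S>'" "x \<in> A"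
    show "\<exists>B\<in>\<S>. card ((A - {x}) \<inter> B) < t"
    proof (rule ccontr)
      assume no: "\<not> (\<exists>B\<in>\<S>. card ((A - {x}) \<inter> B) < t)"
      have "approximates V t b \<epsilon> \<G> \<F> (insert (A - {x}) (\<S>' - {A}), \<S>)"
        using approximates_shrink[OF V fin(2) _ A no] Q approximates_swap SS by blast
      from min[OF this[unfolded approximates_swap[of V t b \<epsilon> \<G>]]]
      show False using sum_card_shrink[OF finS(2) A(1) _ A(2)] finA A(1)
        by (simp add: \<mu>_def SS)
    qed
  qed
  ultimately show thesis using that Q SS by simp
qed

section \<open>Rounds of peeling and their loss\<close>

context large_n
begin

lemma card_superset_le:
  assumes "\<F> \<subseteq> nsets {1..n} k" and "A \<subseteq> {1..n}" and "card A = t + q" and "1 \<le> q" and "q \<le> w"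
  shows "real (card {F \<in> \<F>. A \<subseteq> F}) \<le> p ^ (q - 1) * N"
proof -
  have "card {F \<in> \<F>. A \<subseteq> F} \<le> card {F \<in> nsets {1..n} k. A \<subseteq> F}"
    by (intro card_filter_mono finite_imp_finite_nsets assms(1)) simp
  also have "\<dots> = (m - q) choose (w - q)"
    using assms card_nsets_superset[of "{1..n}" A k] n_eq k_eq by simp
  finally show ?thesis using binomial_decay[OF assms(4,5)] by linarith
qed

text \<open>The meaning of \<open>T q\<close>: the number of dropped sets times
  \<open>p ^ (q - 1)\<close>, where at most \<open>p ^ (q - 1) * N\<close> members contain any one
  of them.\<close>

lemma card_uncovered_drop:
  assumes F: "\<F> \<subseteq> nsets {1..n} k" and q: "1 \<le> q" "q \<le> w"
    and S: "\<And>A. A \<in> \<S> \<Longrightarrow> A \<subseteq> {1..n}"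
    and W: "card {A \<in> \<S>. card A = t + q} \<le> ((t + q) choose t) * (q + 1) ^ q"
  shows "real (card (uncovered \<F> {A \<in> \<S>. card A \<noteq> t + q})) \<le> real (card (uncovered \<F> \<S>)) + T q * N"
proof -
  let ?W = "{A \<in> \<S>. card A = t + q}"
  have finF: "finite \<F>" using finite_nsets_sub[OF _ F] by simp
  have "\<S> \<subseteq> Pow {1..n}" using S by auto
  then have finS: "finite \<S>" by (rule finite_subset) simp
  have "uncovered \<F> {A \<in> \<S>. card A \<noteq> t + q}
      \<subseteq> uncovered \<F> \<S> \<union> (\<Union>A\<in>?W. {F \<in> \<F>. A \<subseteq> F})"
    unfolding uncovered_def by blast
  moreover have "finite (uncovered \<F> \<S>)" using finF by (simp add: uncovered_def)
  moreover have "finite (\<Union>A\<in>?W. {F \<in> \<F>. A \<subseteq> F})" using finF finS by simp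
  ultimately have "card (uncovered \<F> {A \<in> \<S>. card A \<noteq> t + q})
      \<le> card (uncovered \<F> \<S> \<union> (\<Union>A\<in>?W. {F \<in> \<F>. A \<subseteq> F}))"
    by (intro card_mono finite_UnI)
  also have "\<dots> \<le> card (uncovered \<F> \<S>) + card (\<Union>A\<in>?W. {F \<in> \<F>. A \<subseteq> F})" by (rule card_Un_le)
  also have "\<dots> \<le> card (uncovered \<F> \<S>) + (\<Sum>A\<in>?W. card {F \<in> \<F>. A \<subseteq> F})"
    using finS by (intro add_left_mono card_UN_le) simp
  finally have "real (card (uncovered \<F> {A \<in> \<S>. card A \<noteq> t + q}))
      \<le> real (card (uncovered \<F> \<S>)) + (\<Sum>A\<in>?W. real (card {F \<in> \<F>. A \<subseteq> F}))"
    by (simp flip: of_nat_add of_nat_sum)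
  also have "(\<Sum>A\<in>?W. real (card {F \<in> \<F>. A \<subseteq> F})) \<le> (\<Sum>A\<in>?W. p ^ (q - 1) * N)"
    by (intro sum_mono card_superset_le[OF F _ _ q] S) simp_all
  also have "\<dots> = real (card ?W) * (p ^ (q - 1) * N)" by simp
  also have "\<dots> \<le> real (((t + q) choose t) * (q + 1) ^ q) * (p ^ (q - 1) * N)"
    using W p_pos N_ge by (intro mult_right_mono of_nat_mono) auto
  also have "\<dots> = T q * N" by (simp add: T_def add.commute)
  finally show ?thesis by simp
qed

text \<open>Downward induction on \<open>q\<close>: at \<open>q = w\<close> the families are their
  own kernels and the loss is an empty sum.\<close>

lemma peeling:
  assumes F: "\<F> \<subseteq> nsets {1..n} k" and G: "\<G> \<subseteq> nsets {1..n} k"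
    and cross: "cross_intersecting t \<F> \<G>"
  obtains \<S> \<S>' where "approximates {1..n} t (t + 1) (E * N) \<F> \<G> (\<S>, \<S>')"
proof -
  have fin: "finite \<F>" "finite \<G>" using finite_nsets_sub[OF _ F] finite_nsets_sub[OF _ G] by simp_all
  have "\<exists>P. approximates {1..n} t (t + q) ((\<Sum>i=Suc q..w. T i) * N) \<F> \<G> P"
    if "1 \<le> q" "q \<le> w" for q
    using that(2,1)
  proof (induction q rule: inc_induct)
    case base
    have "uncovered \<F> \<F> = {}" "uncovered \<G> \<G> = {}" by (auto simp: uncovered_def)
    then have "approximates {1..n} t (t + w) ((\<Sum>i=Suc w..w. T i) * N) \<F> \<G> (\<F>, \<G>)"
      using F G cross k_eq by (auto simp: approximates_def nsets_def)
    then show ?case by blast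
  next
    case (step q)
    then obtain P where P: "approximates {1..n} t (t + Suc q) ((\<Sum>i=Suc (Suc q)..w. T i) * N) \<F> \<G> P"
      by auto
    obtain \<S> \<S>' where S: "approximates {1..n} t (t + Suc q) ((\<Sum>i=Suc (Suc q)..w. T i) * N) \<F> \<G> (\<S>, \<S>')"
      and irr: "irreducible_wrt t \<S> \<S>'" "irreducible_wrt t \<S>' \<S>"
      using approximates_irreducible[OF _ fin P] by auto
    have cr: "cross_intersecting t \<S> \<S>'" "cross_intersecting t \<S>' \<S>"
      using S cross_intersecting_sym by (auto simp: approximates_def)
    have sub: "A \<subseteq> {1..n} \<and> card A \<le> t + Suc q" if "A \<in> \<S> \<or> A \<in> \<S>'" for A
      using S that by (auto simp: approximates_def)
    define \<S>1 \<S>2 where "\<S>1 = {A \<in> \<S>. card A \<noteq> t + Suc q}" "\<S>2 = {A \<in> \<S>'. card A \<noteq> t + Suc q}"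
    have le: "card A \<le> t + q" if "A \<in> \<S>1 \<or> A \<in> \<S>2" for A
    proof -
      have "card A \<noteq> t + Suc q" "card A \<le> t + Suc q" using that sub[of A] by (auto simp: \<S>1_\<S>2_def)
      then show ?thesis by simp
    qed
    have sm: "(\<Sum>i=Suc q..w. T i) = T (Suc q) + (\<Sum>i=Suc (Suc q)..w. T i)"
      using step by (intro sum.atLeast_Suc_atMost) simp
    have q: "1 \<le> Suc q" "Suc q \<le> w" using step by auto
    have "card {A \<in> \<S>. card A = t + Suc q} \<le> ((t + Suc q) choose t) * (Suc q + 1) ^ Suc q"
      using sub cr irr by (intro card_top_layer[of "{1..n}" _ _ \<S>']) auto
    moreover have "card {A \<in> \<S>'. card A = t + Suc q} \<le> ((t + Suc q) choose t) * (Suc q + 1) ^ Suc q"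
      using sub cr irr by (intro card_top_layer[of "{1..n}" _ _ \<S>]) auto
    ultimately have "real (card (uncovered \<F> \<S>1)) \<le> real (card (uncovered \<F> \<S>)) + T (Suc q) * N"
      "real (card (uncovered \<G> \<S>2)) \<le> real (card (uncovered \<G> \<S>')) + T (Suc q) * N"
      unfolding \<S>1_\<S>2_def using card_uncovered_drop[OF F q] card_uncovered_drop[OF G q] sub by auto
    moreover have "real (card (uncovered \<F> \<S>)) \<le> (\<Sum>i=Suc (Suc q)..w. T i) * N"
      "real (card (uncovered \<G> \<S>')) \<le> (\<Sum>i=Suc (Suc q)..w. T i) * N"
      using S by (simp_all add: approximates_def)
    ultimately have "real (card (uncovered \<F> \<S>1)) \<le> (\<Sum>i=Suc q..w. T i) * N"
      "real (card (uncovered \<G> \<S>2)) \<le> (\<Sum>i=Suc q..w. T i) * N"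
      unfolding sm distrib_right by linarith+
    moreover have "cross_intersecting t \<S>1 \<S>2"
      using cr by (auto simp: cross_intersecting_def \<S>1_\<S>2_def)
    moreover have "\<forall>A\<in>\<S>1 \<union> \<S>2. A \<subseteq> {1..n} \<and> card A \<le> t + q"
      using le sub by (auto simp: \<S>1_\<S>2_def)
    ultimately have "approximates {1..n} t (t + q) ((\<Sum>i=Suc q..w. T i) * N) \<F> \<G> (\<S>1, \<S>2)"
      by (simp add: approximates_def)
    then show ?case by blast
  qed
  from this[of 1] w_ge obtain P where P: "approximates {1..n} t (t + 1) ((\<Sum>i=Suc 1..w. T i) * N) \<F> \<G> P"
    by auto
  moreover have "Suc 1 = 2" by simp
  ultimately show thesis using that by (metis E_def prod.collapse)
qed

section \<open>Families with a common \<open>t\<close>-set\<close>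

text \<open>The size does not depend on how \<open>K\<close> and \<open>L\<close> overlap, so every
  such family can be compared with \<open>famH_std\<close>.\<close>

lemma card_famH:
  assumes X: "X \<in> nsets {1..n} t" and K: "K \<in> nsets {1..n} (k + 1)" and L: "L \<in> nsets {1..n} (k + 1)"
    and XKL: "X \<subseteq> K \<inter> L"
  shows "card (famH n k X K L) = h + t"
proof -
  have Xf: "finite X" "X \<subseteq> {1..n}" "card X = t" using X by (auto simp: nsets_def)
  have Lf: "finite L" "L \<subseteq> {1..n}" "card L = k + 1" using L by (auto simp: nsets_def)
  have "card (L - X) = w + 1" using Xf Lf XKL k_eq by (simp add: card_Diff_subset)
  moreover have "card {F \<in> nsets {1..n} k. X \<subseteq> F \<and> F \<inter> (L - X) \<noteq> {}} =
    ((card {1..n} - card X) choose (k - card X)) - ((card {1..n} - card X - card (L - X)) choose (k - card X))"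
    by (rule card_hitting_nsets) (use Xf Lf k_eq in auto)
  ultimately have 1: "card {F \<in> nsets {1..n} k. X \<subseteq> F \<and> F \<inter> (L - X) \<noteq> {}} = h"
    using Xf k_eq n_eq by (simp add: h_def)
  have im: "{K - {x} | x. x \<in> X} = (\<lambda>x. K - {x}) ` X" by auto
  have "inj_on (\<lambda>x. K - {x}) X" using XKL by (auto simp: inj_on_def)
  then have 2: "card {K - {x} | x. x \<in> X} = t" unfolding im using Xf by (simp add: card_image)
  have "finite {F \<in> nsets {1..n} k. X \<subseteq> F \<and> F \<inter> (L - X) \<noteq> {}}"
    by (simp add: finite_imp_finite_nsets)
  moreover have "finite {K - {x} | x. x \<in> X}" unfolding im using Xf by simp
  moreover have "{F \<in> nsets {1..n} k. X \<subseteq> F \<and> F \<inter> (L - X) \<noteq> {}} \<inter> {K - {x} | x. x \<in> X} = {}"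
    by auto
  ultimately show ?thesis unfolding famH_def by (subst card_Un_disjoint) (simp_all only: 1 2)
qed

text \<open>\<open>F\<close> supplies at most \<open>w + 1\<close> points outside \<open>X\<close>,
  one of which every star member must contain; \<open>h\<close> is the count for exactly
  \<open>w + 1\<close>.\<close>

lemma card_star_le_h:
  assumes X: "X \<in> nsets {1..n} t" and G: "\<G> \<subseteq> nsets {1..n} k" and F: "F \<in> nsets {1..n} k"
    and FX: "card (X \<inter> F) < t" and meet: "\<And>G. G \<in> \<G> \<Longrightarrow> t \<le> card (G \<inter> F)"
  shows "card {G \<in> \<G>. X \<subseteq> G} \<le> h"
proof -
  have Xf: "finite X" "X \<subseteq> {1..n}" "card X = t" using X by (auto simp: nsets_def)
  have Ff: "finite F" "F \<subseteq> {1..n}" "card F \<le> t + w" using F k_eq by (auto simp: nsets_def)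
  from meeting_set[OF Ff(1,3) FX] obtain D where D: "finite D" "card D \<le> w + 1" "D \<subseteq> F - X"
    "\<forall>A. t \<le> card (A \<inter> F) \<longrightarrow> A \<inter> D \<noteq> {}" by (elim exE conjE)
  have "card {G \<in> \<G>. X \<subseteq> G} \<le> card {F \<in> nsets {1..n} k. X \<subseteq> F \<and> F \<inter> D \<noteq> {}}"
  proof (rule card_mono)
    show "{G \<in> \<G>. X \<subseteq> G} \<subseteq> {F \<in> nsets {1..n} k. X \<subseteq> F \<and> F \<inter> D \<noteq> {}}"
      using G meet D(4) by blast
  qed (simp add: finite_imp_finite_nsets)
  also have "\<dots> = ((card {1..n} - card X) choose (k - card X)) - ((card {1..n} - card X - card D) choose (k - card X))"
    by (rule card_hitting_nsets) (use Xf Ff D(3) k_eq in auto)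
  also have "\<dots> = (m choose w) - ((m - card D) choose w)" using Xf k_eq n_eq by simp
  also have "\<dots> \<le> h" unfolding h_def
    using D(2) by (intro diff_le_mono2 binomial_right_mono) auto
  finally show ?thesis .
qed

text \<open>\<open>F\<close> lacks two points of \<open>X\<close>, so even \<open>X\<close> with one
  more point meets \<open>F\<close> in fewer than \<open>t\<close> points and branching works twice.
  The second level brings the factor \<open>(w + 1) p \<le> 5/27\<close>.\<close>

lemma card_star_deep:
  assumes X: "X \<in> nsets {1..n} t" and G: "\<G> \<subseteq> nsets {1..n} k" and F: "F \<in> nsets {1..n} k"
    and FX: "card (X \<inter> F) + 2 \<le> t" and meet: "\<And>G. G \<in> \<G> \<Longrightarrow> t \<le> card (G \<inter> F)"
  shows "real (card {G \<in> \<G>. X \<subseteq> G}) \<le> 5/27 * (real w + 1) * N"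
proof -
  have Xf: "finite X" "X \<subseteq> {1..n}" "card X = t" using X by (auto simp: nsets_def)
  have Ff: "finite F" "F \<subseteq> {1..n}" "card F \<le> t + w" using F k_eq by (auto simp: nsets_def)
  have "card {G \<in> \<G>. X \<subseteq> G} \<le> (w + 1) ^ (t + 2 - card X) * ((card {1..n} - (t + 2)) choose (k - (t + 2)))"
  proof (rule card_branching[OF _ G])
    fix T assume T: "X \<subseteq> T" "T \<subseteq> {1..n}" "card T < t + 2"
    have finT: "finite T" using T(2) by (rule finite_subset) simp
    have "T \<inter> F \<subseteq> (X \<inter> F) \<union> (T - X)" by auto
    then have "card (T \<inter> F) \<le> card ((X \<inter> F) \<union> (T - X))" using finT Xf by (intro card_mono) auto
    also have "\<dots> \<le> card (X \<inter> F) + card (T - X)" by (rule card_Un_le)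
    also have "card (T - X) = card T - t" using T(1) Xf by (simp add: card_Diff_subset)
    finally have "card (T \<inter> F) < t" using FX T(3) by linarith
    from meeting_set[OF Ff(1,3) this] obtain D where D: "finite D" "card D \<le> w + 1" "D \<subseteq> F - T"
      "\<forall>A. t \<le> card (A \<inter> F) \<longrightarrow> A \<inter> D \<noteq> {}" by (elim exE conjE)
    moreover have "D \<inter> T = {}" using D(3) by auto
    ultimately show "\<exists>C. finite C \<and> card C \<le> w + 1 \<and> C \<inter> T = {} \<and> (\<forall>A\<in>\<G>. T \<subseteq> A \<longrightarrow> A \<inter> C \<noteq> {})"
      using meet by (intro exI[of _ D]) simp
  qed (use Xf in auto)
  then have "card {G \<in> \<G>. X \<subseteq> G} \<le> (w + 1) ^ 2 * ((m - 2) choose (w - 2))"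
    using Xf n_eq k_eq by simp
  then have "real (card {G \<in> \<G>. X \<subseteq> G}) \<le> real ((w + 1) ^ 2 * ((m - 2) choose (w - 2)))"
    by (rule of_nat_mono)
  also have "\<dots> = (real w + 1) ^ 2 * real ((m - 2) choose (w - 2))" by (simp add: add.commute)
  also have "\<dots> \<le> (real w + 1) ^ 2 * (p * N)" by (intro mult_left_mono binomial_decay_2) simp
  also have "\<dots> = (real w + 1) * N * ((real w + 1) * p)" by (simp add: power2_eq_square)
  also have "\<dots> \<le> (real w + 1) * N * (5/27)"
    using p_le_w p_pos N_ge by (intro mult_left_mono) (auto simp: algebra_simps)
  finally show ?thesis by (simp only: mult_ac)
qed

text \<open>A star member must hit both \<open>F1 - X\<close> and \<open>F2 - X\<close>. For
  \<open>a\<close> in the first but not the second, the sets through \<open>X\<close> and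
  \<open>a\<close> that avoid \<open>F2 - X\<close> are counted by \<open>h\<close> but excluded
  from \<G>, and there are at least \<open>22/27 * N\<close> of them.\<close>

lemma card_star_two_traces:
  assumes X: "X \<in> nsets {1..n} t" and G: "\<G> \<subseteq> nsets {1..n} k"
    and F: "F1 \<in> nsets {1..n} k" "F2 \<in> nsets {1..n} k"
    and FX: "card (F1 \<inter> X) + 1 = t" "card (F2 \<inter> X) + 1 = t" and neq: "F1 - X \<noteq> F2 - X"
    and meet: "\<And>G. G \<in> \<G> \<Longrightarrow> t \<le> card (G \<inter> F1) \<and> t \<le> card (G \<inter> F2)"
  shows "real (card {G \<in> \<G>. X \<subseteq> G}) + 22/27 * N \<le> real h"
proof -
  have Xf: "finite X" "X \<subseteq> {1..n}" "card X = t" using X by (auto simp: nsets_def)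
  have hit: "card (F - X) = w + 1 \<and> F - X \<subseteq> {1..n} - X \<and> finite (F - X) \<and>
      (\<forall>G\<in>\<G>. X \<subseteq> G \<longrightarrow> t \<le> card (G \<inter> F) \<longrightarrow> G \<inter> (F - X) \<noteq> {})"
    if F: "F \<in> nsets {1..n} k" and FX: "card (F \<inter> X) + 1 = t" for F
  proof (intro conjI ballI impI)
    have Ff: "finite F" "F \<subseteq> {1..n}" "card F = t + w" using F k_eq by (auto simp: nsets_def)
    show "card (F - X) = w + 1" using FX Ff Xf by (simp add: card_Diff_subset_Int)
    show "F - X \<subseteq> {1..n} - X" "finite (F - X)" using Ff by auto
    fix G assume G: "t \<le> card (G \<inter> F)"
    show "G \<inter> (F - X) \<noteq> {}"
    proof
      assume "G \<inter> (F - X) = {}"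
      then have "G \<inter> F \<subseteq> F \<inter> X" by auto
      then have "card (G \<inter> F) \<le> card (F \<inter> X)" using Ff by (intro card_mono) auto
      then show False using G FX by simp
    qed
  qed
  note h1 = hit[OF F(1) FX(1)] and h2 = hit[OF F(2) FX(2)]
  have "\<not> F1 - X \<subseteq> F2 - X"
  proof
    assume "F1 - X \<subseteq> F2 - X"
    then have "F1 - X = F2 - X" using h1 h2 by (intro card_seteq) auto
    then show False using neq by simp
  qed
  then obtain a where a: "a \<in> F1 - X" "a \<notin> F2 - X" by auto
  let ?U = "{F \<in> nsets {1..n} k. X \<subseteq> F \<and> F \<inter> (F1 - X) \<noteq> {}}"
  let ?S = "insert a X" and ?Z = "insert a (X \<union> (F2 - X))"
  let ?W = "{F \<in> nsets {1..n} k. F \<inter> ?Z = ?S}"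
  have "card ?U = ((card {1..n} - card X) choose (k - card X)) - ((card {1..n} - card X - card (F1 - X)) choose (k - card X))"
    by (rule card_hitting_nsets) (use Xf h1 k_eq in auto)
  then have U: "card ?U = h" using Xf h1 k_eq n_eq by (simp add: h_def)
  have "a \<in> {1..n}" "a \<notin> X" using a h1 by auto
  have cS: "card ?S = t + 1" using a Xf by simp
  have "card (X \<union> (F2 - X)) = card X + card (F2 - X)" using Xf h2 by (intro card_Un_disjoint) auto
  then have cZ: "card ?Z = t + w + 2" using a Xf h2 by simp
  have "card ?W = (card {1..n} - card ?Z) choose (k - card ?S)"
    by (rule card_nsets_trace) (use Xf h2 \<open>a \<in> {1..n}\<close> cS k_eq w_ge in auto)
  also have "\<dots> = (m - 1 - (w + 1)) choose (w - 1)"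
    unfolding cS cZ using n_eq k_eq by simp
  finally have W: "card ?W = (m - 1 - (w + 1)) choose (w - 1)" .
  have disj: "{G \<in> \<G>. X \<subseteq> G} \<inter> ?W = {}"
  proof (rule ccontr)
    assume "{G \<in> \<G>. X \<subseteq> G} \<inter> ?W \<noteq> {}"
    then obtain G where G: "G \<in> \<G>" "X \<subseteq> G" "G \<inter> ?Z = ?S" by auto
    have "G \<inter> (F2 - X) \<noteq> {}" using h2 G meet by simp
    then obtain y where y: "y \<in> G" "y \<in> F2 - X" by auto
    then have "y \<in> G \<inter> ?Z" by auto
    then have "y \<in> insert a X" by (simp only: G(3))
    then show False using y a by auto
  qed
  have finU: "finite ?U" by (simp add: finite_imp_finite_nsets)
  have "X \<subseteq> F \<and> F \<inter> (F1 - X) \<noteq> {}" if "F \<inter> ?Z = ?S" for F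
  proof -
    have "insert a X \<subseteq> F" using that by auto
    then show ?thesis using a by auto
  qed
  then have WU: "?W \<subseteq> ?U" by auto
  have GU: "{G \<in> \<G>. X \<subseteq> G} \<subseteq> ?U" using G h1 meet by auto
  have "card ({G \<in> \<G>. X \<subseteq> G} \<union> ?W) = card {G \<in> \<G>. X \<subseteq> G} + card ?W"
    using finite_subset[OF GU finU] finite_subset[OF WU finU] disj by (rule card_Un_disjoint)
  moreover have "card ({G \<in> \<G>. X \<subseteq> G} \<union> ?W) \<le> card ?U"
    using finU WU GU by (intro card_mono) auto
  ultimately have "card {G \<in> \<G>. X \<subseteq> G} + ((m - 1 - (w + 1)) choose (w - 1)) \<le> h"
    unfolding U W by simp
  then have "real (card {G \<in> \<G>. X \<subseteq> G}) + real ((m - 1 - (w + 1)) choose (w - 1)) \<le> real h"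
    by (simp flip: of_nat_add)
  moreover have "22/27 * N \<le> (1 - real (w + 1) * p) * N"
    using p_le_w p_pos N_ge by (intro mult_right_mono) (auto simp: algebra_simps)
  ultimately show ?thesis using binomial_shift[of "w + 1"] by linarith
qed

text \<open>Outside \<open>X\<close>, a set of \<open>\<G>\<close> missing exactly one point of \<open>X\<close> is a cover of the members of \<open>\<F>\<close>
  through \<open>X\<close>. These are too many to have a cover of size \<open>s\<close>, so branching can be repeated \<open>s + 1\<close>
  times.\<close>

lemma card_near_star:
  assumes X: "X \<in> nsets {1..n} t" and F: "\<F> \<subseteq> nsets {1..n} k" and G: "\<G> \<subseteq> nsets {1..n} k"
    and cross: "cross_intersecting t \<F> \<G>"
    and big: "real (card {F \<in> \<F>. X \<subseteq> F}) > 3 * N" "real (card {F \<in> \<F>. X \<subseteq> F}) > 3/5 * (real w + 1) * N"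
  shows "real (card {G \<in> \<G>. card (G \<inter> X) + 1 = t}) < 22/27 * N"
proof -
  have Xf: "finite X" "X \<subseteq> {1..n}" "card X = t" using X by (auto simp: nsets_def)
  obtain s where s: "2 \<le> s" "s \<le> w" "s \<le> 3 \<or> 5 * s \<le> 3 * (w + 1)"
    "real w ^ 3 * (5/27) ^ (s - 2) < 24" by (rule cover_number_exponent)
  have "real s * N < real (card {F \<in> \<F>. X \<subseteq> F})"
    using s(3)
  proof
    assume "s \<le> 3"
    then have "real s * N \<le> 3 * N" using N_ge by (intro mult_right_mono) auto
    then show ?thesis using big by linarith
  next
    assume "5 * s \<le> 3 * (w + 1)"
    then have "real (5 * s) \<le> real (3 * (w + 1))" by (rule of_nat_mono)
    then have "real s * N \<le> 3/5 * (real w + 1) * N" using N_ge by (intro mult_right_mono) auto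
    then show ?thesis using big by linarith
  qed
  note sbig = this
  \<comment> \<open>A point outside \<open>X\<close> lies in at most \<open>N\<close> of the members
    through \<open>X\<close>, so \<open>s\<close> points cover at most \<open>s * N\<close>.\<close>
  have nocover: "\<exists>F\<in>\<F>. X \<subseteq> F \<and> F \<inter> C = {}"
    if C: "finite C" "C \<subseteq> {1..n} - X" "card C \<le> s" for C
  proof (rule ccontr)
    assume no: "\<not> ?thesis"
    have finF: "finite \<F>" using finite_nsets_sub[OF _ F] by simp
    have "card {F \<in> \<F>. X \<subseteq> F} \<le> card (\<Union>z\<in>C. {F \<in> \<F>. insert z X \<subseteq> F})"
      using no finF C by (intro card_mono) auto
    also have "\<dots> \<le> (\<Sum>z\<in>C. card {F \<in> \<F>. insert z X \<subseteq> F})" by (rule card_UN_le[OF C(1)])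
    finally have "real (card {F \<in> \<F>. X \<subseteq> F}) \<le> (\<Sum>z\<in>C. real (card {F \<in> \<F>. insert z X \<subseteq> F}))"
      by (simp flip: of_nat_sum)
    also have "\<dots> \<le> (\<Sum>z\<in>C. N)"
    proof (rule sum_mono)
      fix z assume z: "z \<in> C"
      then have "z \<in> {1..n}" "z \<notin> X" using C by auto
      then show "real (card {F \<in> \<F>. insert z X \<subseteq> F}) \<le> N"
        using card_superset_le[OF F, of "insert z X" 1] Xf w_ge by simp
    qed
    also have "\<dots> = real (card C) * N" by simp
    also have "\<dots> \<le> real s * N" using C N_ge by (intro mult_right_mono) auto
    finally show False using sbig by simp
  qed
  let ?A = "\<lambda>x. {G \<in> \<G>. G \<inter> X = X - {x}}"
  have each: "card (?A x) \<le> w ^ (s + 1) * ((m - 1 - s) choose (w - s))" if x: "x \<in> X" for x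
  proof -
    \<comment> \<open>Removing \<open>x\<close> from the ground set keeps it out of all nodes. From
      \<open>t - 1\<close> to \<open>t + s\<close> points takes \<open>s + 1\<close> steps.\<close>
    have sub: "?A x \<subseteq> nsets ({1..n} - {x}) k" using G x by (auto simp: nsets_def)
    have "card {G \<in> ?A x. X - {x} \<subseteq> G} \<le> w ^ (t + s - card (X - {x}))
        * ((card ({1..n} - {x}) - (t + s)) choose (k - (t + s)))"
    proof (rule card_branching[OF _ sub])
      fix T assume T: "X - {x} \<subseteq> T" "T \<subseteq> {1..n} - {x}" "card T < t + s"
      have finT: "finite T" using T(2) by (rule finite_subset) simp
      have "T - X = T - (X - {x})" using T by auto
      then have "card (T - X) = card T - (t - 1)"
        using T(1) Xf x finT by (simp add: card_Diff_subset)
      then have "card (T - X) \<le> s" using T(3) by simp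
      then obtain F where F': "F \<in> \<F>" "X \<subseteq> F" "F \<inter> (T - X) = {}"
        using nocover[of "T - X"] finT T(2) by auto
      have Ff: "finite F" "card F = t + w" using F' F k_eq by (auto simp: nsets_def)
      \<comment> \<open>Inside \<open>X\<close> the two sets share at most \<open>t - 1\<close>
        points, so \<open>G\<close> needs one of the \<open>w\<close> points of
        \<open>F - X\<close>.\<close>
      have "G \<inter> (F - X) \<noteq> {}" if G': "G \<in> ?A x" for G
      proof
        assume "G \<inter> (F - X) = {}"
        then have "G \<inter> F \<subseteq> X - {x}" using G' by auto
        then have "card (F \<inter> G) \<le> card (X - {x})" using Xf by (intro card_mono) auto
        moreover have "t \<le> card (F \<inter> G)" using cross F' G' by (simp add: cross_intersecting_def)
        ultimately show False using x Xf t_ge by simp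
      qed
      moreover have "card (F - X) = w" using F' Ff Xf by (simp add: card_Diff_subset)
      moreover have "(F - X) \<inter> T = {}" using F'(3) by auto
      ultimately show "\<exists>C. finite C \<and> card C \<le> w \<and> C \<inter> T = {} \<and> (\<forall>A\<in>?A x. T \<subseteq> A \<longrightarrow> A \<inter> C \<noteq> {})"
        using Ff by (intro exI[of _ "F - X"]) simp
    qed (use Xf x in auto)
    moreover have "{G \<in> ?A x. X - {x} \<subseteq> G} = ?A x" by auto
    moreover have "card ({1..n} - {x}) = n - 1" using x Xf by auto
    moreover have "t + s - (t - 1) = s + 1" using t_ge by simp
    ultimately show ?thesis using x Xf n_eq k_eq by (simp add: add.commute)
  qed
  have "{G \<in> \<G>. card (G \<inter> X) + 1 = t} \<subseteq> (\<Union>x\<in>X. ?A x)"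
  proof
    fix G assume G': "G \<in> {G \<in> \<G>. card (G \<inter> X) + 1 = t}"
    then have "\<not> X \<subseteq> G" using Xf by (auto simp: inf_absorb2)
    then obtain x where x: "x \<in> X" "x \<notin> G" by auto
    have "G \<inter> X = X - {x}" using G' x Xf by (intro card_seteq) auto
    then show "G \<in> (\<Union>x\<in>X. ?A x)" using x G' by auto
  qed
  moreover have "finite \<G>" using finite_nsets_sub[OF _ G] by simp
  ultimately have "card {G \<in> \<G>. card (G \<inter> X) + 1 = t} \<le> card (\<Union>x\<in>X. ?A x)"
    using Xf by (intro card_mono) auto
  also have "\<dots> \<le> (\<Sum>x\<in>X. card (?A x))" by (rule card_UN_le[OF Xf(1)])
  also have "\<dots> \<le> (\<Sum>x\<in>X. w ^ (s + 1) * ((m - 1 - s) choose (w - s)))" by (intro sum_mono each)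
  also have "\<dots> = t * (w ^ (s + 1) * ((m - 1 - s) choose (w - s)))" using Xf by simp
  finally have "real (card {G \<in> \<G>. card (G \<inter> X) + 1 = t})
      \<le> real (t * (w ^ (s + 1) * ((m - 1 - s) choose (w - s))))" by (rule of_nat_mono)
  also have "\<dots> = real t * real w ^ (s + 1) * real ((m - 1 - s) choose (w - s))" by simp
  also have "\<dots> \<le> real t * real w ^ (s + 1) * (p ^ (s - 1) * N)"
  proof (intro mult_left_mono)
    have "real ((m - 1 - s) choose (w - s)) \<le> real ((m - s) choose (w - s))"
      by (intro of_nat_mono binomial_right_mono) simp
    then show "real ((m - 1 - s) choose (w - s)) \<le> p ^ (s - 1) * N"
      using binomial_decay[of s] s by simp
  qed auto
  \<comment> \<open>One factor \<open>p\<close> absorbs \<open>t\<close>, the others absorb all but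
    three of the factors \<open>w\<close>.\<close>
  also have "\<dots> = (real t * p) * real w ^ 3 * (real w * p) ^ (s - 2) * N"
  proof -
    obtain j where "s = j + 2" using s(1) by (metis add.commute le_Suc_ex)
    then show ?thesis by (simp add: power_mult_distrib power3_eq_cube mult_ac)
  qed
  also have "\<dots> \<le> 1/30 * real w ^ 3 * (5/27) ^ (s - 2) * N"
  proof (intro mult_right_mono mult_mono power_mono)
    show "real t * p \<le> 1/30" using p_le_t p_pos by (simp add: algebra_simps)
    show "real w * p \<le> 5/27" using p_le_w p_pos by (simp add: algebra_simps)
  qed (use p_pos N_ge in auto)
  also have "\<dots> = 1/30 * (real w ^ 3 * (5/27) ^ (s - 2)) * N" by simp
  \<comment> \<open>24/30 = 4/5 < 22/27.\<close>
  also have "\<dots> < 22/27 * N"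
    using s(4) N_ge by (intro mult_strict_right_mono) auto
  finally show ?thesis .
qed

lemma star_outside:
  assumes X: "X \<in> nsets {1..n} t" and F: "\<F> \<subseteq> nsets {1..n} k" and G: "\<G> \<subseteq> nsets {1..n} k"
    and cross: "cross_intersecting t \<F> \<G>"
    and big: "real (card {G \<in> \<G>. X \<subseteq> G}) > 3/5 * (real w + 1) * N"
    and F1: "F1 \<in> \<F>" "\<not> X \<subseteq> F1"
  shows "card (F1 \<inter> X) + 1 = t"
proof -
  have Xf: "finite X" "card X = t" using X by (auto simp: nsets_def)
  have "X \<inter> F1 \<subset> X" using F1 by auto
  from psubset_card_mono[OF Xf(1) this] have lt: "card (X \<inter> F1) < t" using Xf by simp
  have "\<not> card (X \<inter> F1) + 2 \<le> t"
  proof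
    assume le: "card (X \<inter> F1) + 2 \<le> t"
    have "real (card {G \<in> \<G>. X \<subseteq> G}) \<le> 5/27 * (real w + 1) * N"
    proof (rule card_star_deep[OF X G _ le])
      show "F1 \<in> nsets {1..n} k" using F F1 by auto
      show "t \<le> card (G \<inter> F1)" if "G \<in> \<G>" for G
        using cross F1 that by (simp add: cross_intersecting_def Int_commute)
    qed
    also have "\<dots> \<le> 3/5 * (real w + 1) * N" using N_ge by (intro mult_right_mono) auto
    finally show False using big by simp
  qed
  then show ?thesis using lt by (simp add: Int_commute)
qed

text \<open>A second trace pushes the star of \<G> below \<open>h\<close> by
  \<open>22/27 * N\<close>, and the members off the star are too few to make up for it, so
  \<open>card \<G> < h\<close>.\<close>

lemma star_outside_trace:
  assumes X: "X \<in> nsets {1..n} t" and F: "\<F> \<subseteq> nsets {1..n} k" and G: "\<G> \<subseteq> nsets {1..n} k"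
    and cross: "cross_intersecting t \<F> \<G>"
    and bigF: "real (card {F \<in> \<F>. X \<subseteq> F}) > 3 * N" "real (card {F \<in> \<F>. X \<subseteq> F}) > 3/5 * (real w + 1) * N"
    and bigG: "real (card {G \<in> \<G>. X \<subseteq> G}) > 3/5 * (real w + 1) * N"
    and cardG: "h \<le> card \<G>"
    and F1: "F1 \<in> \<F>" "\<not> X \<subseteq> F1" and F2: "F2 \<in> \<F>" "\<not> X \<subseteq> F2"
  shows "F1 - X = F2 - X"
proof (rule ccontr)
  assume neq: "F1 - X \<noteq> F2 - X"
  have cross': "cross_intersecting t \<G> \<F>" using cross cross_intersecting_sym by simp
  have finG: "finite \<G>" using finite_nsets_sub[OF _ G] by simp
  have "real (card {G \<in> \<G>. X \<subseteq> G}) + 22/27 * N \<le> real h"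
  proof (rule card_star_two_traces[OF X G _ _ _ _ neq])
    show "F1 \<in> nsets {1..n} k" "F2 \<in> nsets {1..n} k" using F F1 F2 by auto
    show "card (F1 \<inter> X) + 1 = t" by (rule star_outside[OF X F G cross bigG F1])
    show "card (F2 \<inter> X) + 1 = t" by (rule star_outside[OF X F G cross bigG F2])
    show "t \<le> card (G \<inter> F1) \<and> t \<le> card (G \<inter> F2)" if "G \<in> \<G>" for G
      using cross' F1 F2 that by (simp add: cross_intersecting_def)
  qed
  moreover have "card \<G> \<le> card {G \<in> \<G>. X \<subseteq> G} + card {G \<in> \<G>. card (G \<inter> X) + 1 = t}"
  proof -
    have "\<G> \<subseteq> {G \<in> \<G>. X \<subseteq> G} \<union> {G \<in> \<G>. card (G \<inter> X) + 1 = t}"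
    proof
      fix A assume A: "A \<in> \<G>"
      show "A \<in> {G \<in> \<G>. X \<subseteq> G} \<union> {G \<in> \<G>. card (G \<inter> X) + 1 = t}"
        using A star_outside[OF X G F cross' bigF(2) A] by (cases "X \<subseteq> A") auto
    qed
    then have "card \<G> \<le> card ({G \<in> \<G>. X \<subseteq> G} \<union> {G \<in> \<G>. card (G \<inter> X) + 1 = t})"
      using finG by (intro card_mono) auto
    also have "\<dots> \<le> card {G \<in> \<G>. X \<subseteq> G} + card {G \<in> \<G>. card (G \<inter> X) + 1 = t}"
      by (rule card_Un_le)
    finally show ?thesis .
  qed
  ultimately show False using card_near_star[OF X F G cross bigF] cardG by linarith
qed

lemma subset_famH:
  assumes X: "X \<in> nsets {1..n} t" and F: "\<F> \<subseteq> nsets {1..n} k"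
    and near: "\<And>A. A \<in> \<F> \<Longrightarrow> \<not> X \<subseteq> A \<Longrightarrow> card (A \<inter> X) + 1 = t \<and> A - X = D"
    and G0: "G0 \<in> nsets {1..n} k" "card (G0 \<inter> X) + 1 = t" "\<And>A. A \<in> \<F> \<Longrightarrow> t \<le> card (A \<inter> G0)"
  shows "\<F> \<subseteq> famH n k X (X \<union> D) (X \<union> (G0 - X))"
proof
  fix A assume A: "A \<in> \<F>"
  have Xf: "finite X" "card X = t" using X by (auto simp: nsets_def)
  have fG0: "finite G0" using G0 by (auto simp: nsets_def)
  show "A \<in> famH n k X (X \<union> D) (X \<union> (G0 - X))"
  proof (cases "X \<subseteq> A")
    case True
    have "A \<inter> (G0 - X) \<noteq> {}"
    proof
      assume "A \<inter> (G0 - X) = {}"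
      then have "A \<inter> G0 \<subseteq> G0 \<inter> X" by auto
      then have "card (A \<inter> G0) \<le> card (G0 \<inter> X)" using Xf by (intro card_mono) auto
      then show False using G0(2) G0(3)[OF A] by simp
    qed
    moreover have "X \<union> (G0 - X) - X = G0 - X" by auto
    ultimately show ?thesis using True A F by (auto simp: famH_def)
  next
    case False
    then obtain x where x: "x \<in> X" "x \<notin> A" by auto
    have c: "card (A \<inter> X) + 1 = t" "A - X = D" using near[OF A False] by auto
    have "A \<inter> X = X - {x}" using x c Xf by (intro card_seteq) auto
    then have "A = (X \<union> D) - {x}" using c(2) x by auto
    then show ?thesis using x(1) by (auto simp: famH_def)
  qed
qed

lemma star_case:
  assumes X: "X \<in> nsets {1..n} t" and F: "\<F> \<subseteq> nsets {1..n} k" and G: "\<G> \<subseteq> nsets {1..n} k"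
    and cross: "cross_intersecting t \<F> \<G>"
    and bigF: "real (card {F \<in> \<F>. X \<subseteq> F}) > 3 * N" "real (card {F \<in> \<F>. X \<subseteq> F}) > 3/5 * (real w + 1) * N"
    and bigG: "real (card {G \<in> \<G>. X \<subseteq> G}) > 3 * N" "real (card {G \<in> \<G>. X \<subseteq> G}) > 3/5 * (real w + 1) * N"
    and card: "h + t \<le> card \<F>" "h + t \<le> card \<G>"
    and nontriv: "\<not> (\<forall>A\<in>\<F> \<union> \<G>. X \<subseteq> A)"
  shows "\<exists>X K L. X \<in> nsets {1..n} t \<and> K \<in> nsets {1..n} (k + 1) \<and> L \<in> nsets {1..n} (k + 1)
    \<and> X \<subseteq> K \<inter> L \<and> card (K \<inter> L) \<ge> t + 2 \<and> \<F> = famH n k X K L \<and> \<G> = famH n k X L K"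
proof -
  have cross': "cross_intersecting t \<G> \<F>" using cross cross_intersecting_sym by simp
  have Xf: "finite X" "X \<subseteq> {1..n}" "card X = t" using X by (auto simp: nsets_def)
  \<comment> \<open>If only one family left the star, the other would have at most \<open>h\<close>
    members, short of \<open>h + t\<close>.\<close>
  have small: "\<exists>B\<in>\<B>. \<not> X \<subseteq> B"
    if AB: "\<A> \<subseteq> nsets {1..n} k" "\<B> \<subseteq> nsets {1..n} k" "cross_intersecting t \<A> \<B>" "h + t \<le> card \<B>"
      and A: "A \<in> \<A>" "\<not> X \<subseteq> A" for \<A> \<B> A
  proof (rule ccontr)
    assume "\<not> (\<exists>B\<in>\<B>. \<not> X \<subseteq> B)"
    then have "{B \<in> \<B>. X \<subseteq> B} = \<B>" by auto
    moreover have "card {B \<in> \<B>. X \<subseteq> B} \<le> h"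
    proof (rule card_star_le_h[OF X AB(2)])
      show "A \<in> nsets {1..n} k" using AB A by auto
      have "X \<inter> A \<subset> X" using A by auto
      from psubset_card_mono[OF Xf(1) this] show "card (X \<inter> A) < t" using Xf by simp
      show "t \<le> card (B \<inter> A)" if "B \<in> \<B>" for B
        using AB(3) A that by (simp add: cross_intersecting_def Int_commute)
    qed
    ultimately show False using AB(4) t_ge by simp
  qed
  have ex: "(\<exists>A\<in>\<F>. \<not> X \<subseteq> A) \<and> (\<exists>B\<in>\<G>. \<not> X \<subseteq> B)"
    using nontriv small[OF F G cross card(2)] small[OF G F cross' card(1)] by blast
  then obtain F0 G0 where F0: "F0 \<in> \<F>" "\<not> X \<subseteq> F0" and G0: "G0 \<in> \<G>" "\<not> X \<subseteq> G0" by auto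
  have h: "h \<le> card \<F>" "h \<le> card \<G>" using card by simp_all
  note outF = star_outside[OF X F G cross bigG(2)] and outG = star_outside[OF X G F cross' bigF(2)]
  define K L where "K = X \<union> (F0 - X)" "L = X \<union> (G0 - X)"
  have KL: "K \<in> nsets {1..n} (k + 1)" "L \<in> nsets {1..n} (k + 1)"
  proof -
    have *: "X \<union> (A - X) \<in> nsets {1..n} (k + 1)" if A: "A \<in> nsets {1..n} k" "card (A \<inter> X) + 1 = t" for A
    proof -
      have Af: "finite A" "A \<subseteq> {1..n}" "card A = k" using A by (auto simp: nsets_def)
      have "card (A - X) = w + 1" using Af A(2) k_eq Xf by (simp add: card_Diff_subset_Int)
      moreover have "card (X \<union> (A - X)) = card X + card (A - X)"
        using Af Xf by (intro card_Un_disjoint) auto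
      ultimately show ?thesis using Af Xf k_eq by (simp add: nsets_def)
    qed
    show "K \<in> nsets {1..n} (k + 1)" "L \<in> nsets {1..n} (k + 1)"
      unfolding K_L_def using * F G F0 G0 outF[OF F0] outG[OF G0] by auto
  qed
  have XKL: "X \<subseteq> K \<inter> L" "X \<subseteq> L \<inter> K" by (auto simp: K_L_def)
  have "\<F> \<subseteq> famH n k X K L" unfolding K_L_def
  proof (rule subset_famH[OF X F])
    show "card (A \<inter> X) + 1 = t \<and> A - X = F0 - X" if "A \<in> \<F>" "\<not> X \<subseteq> A" for A
      using outF[OF that] star_outside_trace[OF X F G cross bigF bigG(2) h(2) that F0] by simp
    show "G0 \<in> nsets {1..n} k" using G G0 by auto
    show "card (G0 \<inter> X) + 1 = t" by (rule outG[OF G0])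
    show "t \<le> card (A \<inter> G0)" if "A \<in> \<F>" for A
      using cross that G0 by (simp add: cross_intersecting_def)
  qed
  moreover have "finite (famH n k X K L)" by (simp add: famH_def finite_imp_finite_nsets Xf)
  ultimately have FH: "\<F> = famH n k X K L"
    using card_famH[OF X KL XKL(1)] card(1) by (intro card_seteq) simp_all
  have "\<G> \<subseteq> famH n k X L K" unfolding K_L_def
  proof (rule subset_famH[OF X G])
    show "card (A \<inter> X) + 1 = t \<and> A - X = G0 - X" if "A \<in> \<G>" "\<not> X \<subseteq> A" for A
      using outG[OF that] star_outside_trace[OF X G F cross' bigG bigF(2) h(1) that G0] by simp
    show "F0 \<in> nsets {1..n} k" using F F0 by auto
    show "card (F0 \<inter> X) + 1 = t" by (rule outF[OF F0])
    show "t \<le> card (A \<inter> F0)" if "A \<in> \<G>" for A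
      using cross' that F0 by (simp add: cross_intersecting_def)
  qed
  moreover have "finite (famH n k X L K)" by (simp add: famH_def finite_imp_finite_nsets Xf)
  ultimately have GH: "\<G> = famH n k X L K"
    using card_famH[OF X KL(2,1) XKL(2)] card(2) by (intro card_seteq) simp_all
  \<comment> \<open>Deleting distinct points \<open>x\<close> and \<open>y\<close> of
    \<open>X\<close> from \<open>K\<close> and \<open>L\<close> takes two points off
    \<open>K \<inter> L\<close>, and \<open>t\<close> must still remain.\<close>
  have "2 \<le> card X" using Xf t_ge by simp
  then obtain Y where Y: "Y \<subseteq> X" "card Y = 2" by (meson obtain_subset_with_card_n)
  then obtain x y where xy: "x \<in> X" "y \<in> X" "x \<noteq> y" by (auto simp: card_2_iff)
  have "K - {x} \<in> \<F>" "L - {y} \<in> \<G>" using xy FH GH by (auto simp: famH_def)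
  then have "t \<le> card ((K - {x}) \<inter> (L - {y}))" using cross by (simp add: cross_intersecting_def)
  also have "(K - {x}) \<inter> (L - {y}) = K \<inter> L - {x, y}" by auto
  also have "card \<dots> = card (K \<inter> L) - card {x, y}"
    using xy XKL(1) by (intro card_Diff_subset) auto
  finally have "t + 2 \<le> card (K \<inter> L)" using xy t_ge by simp
  then show ?thesis using X KL XKL(1) FH GH by blast
qed

section \<open>Families concentrated on a \<open>(t + 2)\<close>-set\<close>

lemma card_famA:
  assumes Z: "Z \<in> nsets {1..n} (t + 2)"
  shows "card (famA n k t Z) = ((m - 2) choose (w - 2)) + (t + 2) * ((m - 2) choose (w - 1))"
proof -
  have Zf: "finite Z" "Z \<subseteq> {1..n}" "card Z = t + 2" using Z by (auto simp: nsets_def)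
  let ?B = "\<lambda>S. {F \<in> nsets {1..n} k. F \<inter> Z = S}"
  have fin: "finite (?B S)" for S by (simp add: finite_imp_finite_nsets)
  have eq: "famA n k t Z = ?B Z \<union> (\<Union>z\<in>Z. ?B (Z - {z}))"
  proof (intro equalityI subsetI)
    fix F assume F: "F \<in> famA n k t Z"
    then have c: "card (F \<inter> Z) \<ge> t + 1" "F \<in> nsets {1..n} k" by (auto simp: famA_def)
    show "F \<in> ?B Z \<union> (\<Union>z\<in>Z. ?B (Z - {z}))"
    proof (cases "Z \<subseteq> F")
      case True
      then show ?thesis using c by auto
    next
      case False
      then obtain z where z: "z \<in> Z" "z \<notin> F" by auto
      have "F \<inter> Z = Z - {z}"
        using Zf c z by (intro card_seteq) auto
      then show ?thesis using z c by auto
    qed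
  next
    fix F assume "F \<in> ?B Z \<union> (\<Union>z\<in>Z. ?B (Z - {z}))"
    then show "F \<in> famA n k t Z" using Zf by (auto simp: famA_def)
  qed
  have "card (famA n k t Z) = card (?B Z) + card (\<Union>z\<in>Z. ?B (Z - {z}))"
    unfolding eq using fin Zf by (intro card_Un_disjoint) auto
  also have "card (\<Union>z\<in>Z. ?B (Z - {z})) = (\<Sum>z\<in>Z. card (?B (Z - {z})))"
    using fin Zf by (intro card_UN_disjoint) auto
  also have "\<dots> = (\<Sum>z\<in>Z. (m - 2) choose (w - 1))"
  proof (rule sum.cong)
    fix z assume z: "z \<in> Z"
    then have "card (Z - {z}) = t + 1" using Zf by simp
    then show "card (?B (Z - {z})) = (m - 2) choose (w - 1)"
      using card_nsets_trace[of "{1..n}" Z "Z - {z}" k] Zf k_eq n_eq w_ge by auto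
  qed simp
  also have "card (?B Z) = (m - 2) choose (w - 2)"
    using card_nsets_trace[of "{1..n}" Z Z k] Zf k_eq n_eq w_ge by simp
  finally show ?thesis using Zf by simp
qed

lemma card_famA_ge:
  assumes Z: "Z \<in> nsets {1..n} (t + 2)"
  shows "real (card (famA n k t Z)) \<ge> (real t + 2) * N - (real t + 1) * p * N"
proof -
  have "(m - 1) choose (w - 1) = ((m - 2) choose (w - 2)) + ((m - 2) choose (w - 1))"
    using choose_reduce_nat[of "m - 1" "w - 1"] m_gt w_ge by (simp add: numeral_2_eq_2)
  then have "N = real ((m - 2) choose (w - 2)) + real ((m - 2) choose (w - 1))"
    unfolding N_def by (metis of_nat_add)
  then have b: "real ((m - 2) choose (w - 1)) = N - real ((m - 2) choose (w - 2))" by simp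
  have "real (card (famA n k t Z))
      = real ((m - 2) choose (w - 2)) + real (t + 2) * real ((m - 2) choose (w - 1))"
    unfolding card_famA[OF Z] by (simp only: of_nat_add of_nat_mult)
  also have "\<dots> = (real t + 2) * N - (real t + 1) * real ((m - 2) choose (w - 2))"
    unfolding b by (simp add: algebra_simps)
  finally have "real (card (famA n k t Z))
    = (real t + 2) * N - (real t + 1) * real ((m - 2) choose (w - 2))" .
  moreover have "(real t + 1) * real ((m - 2) choose (w - 2)) \<le> (real t + 1) * (p * N)"
    by (intro mult_left_mono binomial_decay_2) auto
  ultimately show ?thesis by (simp only: mult.assoc)
qed

text \<open>\<open>Z - {z}\<close> meets \<open>B\<close> in \<open>t\<close> points only if
  \<open>B \<inter> Z\<close> has exactly \<open>t\<close> points and \<open>z\<close> is one of the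
  two others; \<open>Y\<close> collects these \<open>z\<close>. So at most two of the
  \<open>t + 2\<close> classes may reach size \<open>N\<close>. In the rest every member needs a
  further point of \<open>B\<close>, which brings the factor
  \<open>(w + 1) p \<le> 5/27\<close>.\<close>

lemma card_near_famA:
  assumes Z: "Z \<in> nsets {1..n} (t + 2)" and F: "\<F> \<subseteq> nsets {1..n} k"
    and B: "B \<in> nsets {1..n} k" "card (B \<inter> Z) \<le> t" and meet: "\<And>A. A \<in> \<F> \<Longrightarrow> t \<le> card (A \<inter> B)"
  shows "real (card {A \<in> \<F>. card (A \<inter> Z) \<ge> t + 1}) \<le> 2 * N + 5/27 * real t * N"
proof -
  have Zf: "finite Z" "Z \<subseteq> {1..n}" "card Z = t + 2" using Z by (auto simp: nsets_def)
  have Bf: "finite B" "card B \<le> t + w" using B k_eq by (auto simp: nsets_def)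
  have finF: "finite \<F>" using finite_nsets_sub[OF _ F] by simp
  define Y where "Y = {z \<in> Z. t \<le> card ((Z - {z}) \<inter> B)}"
  have Y: "Y \<subseteq> Z" "finite Y" using Zf by (auto simp: Y_def)
  have "card Y \<le> 2"
  proof (cases "Y = {}")
    case False
    have YB: "z \<notin> B \<and> t \<le> card (B \<inter> Z)" if "z \<in> Y" for z
    proof -
      have z: "z \<in> Z" "t \<le> card ((Z - {z}) \<inter> B)" using that by (auto simp: Y_def)
      have eq: "(Z - {z}) \<inter> B = (B \<inter> Z) - {z}" by auto
      have "z \<notin> B"
      proof
        assume "z \<in> B"
        then have "card ((B \<inter> Z) - {z}) < card (B \<inter> Z)"
          using z Zf by (intro card_Diff1_less) auto
        then show False using z B eq by simp
      qed
      moreover have "card ((B \<inter> Z) - {z}) \<le> card (B \<inter> Z)" using Zf by (intro card_mono) auto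
      ultimately show ?thesis using z eq by simp
    qed
    then have "Y \<subseteq> Z - B" using Y by auto
    moreover have "t \<le> card (B \<inter> Z)" using YB False by auto
    then have "card (Z - B) \<le> 2" using Zf by (simp add: card_Diff_subset_Int Int_commute)
    ultimately show ?thesis using card_mono[of "Z - B" Y] Zf by simp
  qed simp
  have all: "real (card {A \<in> \<F>. Z - {z} \<subseteq> A}) \<le> N" if "z \<in> Z" for z
    using card_superset_le[OF F, of "Z - {z}" 1] Zf that w_ge by auto
  have less: "real (card {A \<in> \<F>. Z - {z} \<subseteq> A}) \<le> 5/27 * N" if z: "z \<in> Z - Y" for z
  proof -
    have lt: "card ((Z - {z}) \<inter> B) < t" using z by (auto simp: Y_def)
    have cz: "card (Z - {z}) = t + 1" using z Zf by simp
    from meeting_set[OF Bf lt] obtain D where D: "finite D" "card D \<le> w + 1" "D \<subseteq> B - (Z - {z})"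
      "\<forall>A. t \<le> card (A \<inter> B) \<longrightarrow> A \<inter> D \<noteq> {}" by (elim exE conjE)
    have "card {A \<in> \<F>. Z - {z} \<subseteq> A}
        \<le> (w + 1) ^ (t + 2 - card (Z - {z})) * ((card {1..n} - (t + 2)) choose (k - (t + 2)))"
    proof (rule card_branching[OF _ F])
      fix T assume T: "Z - {z} \<subseteq> T" "T \<subseteq> {1..n}" "card T < t + 2"
      have "finite T" using T(2) by (rule finite_subset) simp
      then have "Z - {z} = T" using T cz by (intro card_seteq) auto
      then have "D \<inter> T = {}" using D(3) by auto
      then show "\<exists>C. finite C \<and> card C \<le> w + 1 \<and> C \<inter> T = {} \<and> (\<forall>A\<in>\<F>. T \<subseteq> A \<longrightarrow> A \<inter> C \<noteq> {})"
        using D(1,2,4) meet by (intro exI[of _ D]) simp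
    qed (use Zf cz in auto)
    then have "card {A \<in> \<F>. Z - {z} \<subseteq> A} \<le> (w + 1) * ((m - 2) choose (w - 2))"
      using cz n_eq k_eq by simp
    then have "real (card {A \<in> \<F>. Z - {z} \<subseteq> A}) \<le> real ((w + 1) * ((m - 2) choose (w - 2)))"
      by (rule of_nat_mono)
    also have "\<dots> = (real w + 1) * real ((m - 2) choose (w - 2))" by (simp add: algebra_simps)
    also have "\<dots> \<le> (real w + 1) * (p * N)" by (intro mult_left_mono binomial_decay_2) simp
    also have "\<dots> = ((real w + 1) * p) * N" by simp
    also have "\<dots> \<le> 5/27 * N"
      using p_le_w p_pos N_ge by (intro mult_right_mono) (auto simp: algebra_simps)
    finally show ?thesis .
  qed
  have "{A \<in> \<F>. card (A \<inter> Z) \<ge> t + 1} \<subseteq> (\<Union>z\<in>Z. {A \<in> \<F>. Z - {z} \<subseteq> A})"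
  proof
    fix A assume A: "A \<in> {A \<in> \<F>. card (A \<inter> Z) \<ge> t + 1}"
    obtain z0 where z0: "z0 \<in> Z" using Zf by fastforce
    show "A \<in> (\<Union>z\<in>Z. {A \<in> \<F>. Z - {z} \<subseteq> A})"
    proof (cases "Z \<subseteq> A")
      case True
      then show ?thesis using A z0 by auto
    next
      case False
      then obtain z where z: "z \<in> Z" "z \<notin> A" by auto
      have "card Z \<le> Suc (card (A \<inter> Z))" using A Zf by simp
      then have "Z - {z} \<subseteq> A" using Zf z by (intro Diff_singleton_subset_of_card)
      then show ?thesis using A z by auto
    qed
  qed
  then have "card {A \<in> \<F>. card (A \<inter> Z) \<ge> t + 1} \<le> card (\<Union>z\<in>Z. {A \<in> \<F>. Z - {z} \<subseteq> A})"
    using finF Zf by (intro card_mono) auto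
  also have "\<dots> \<le> (\<Sum>z\<in>Z. card {A \<in> \<F>. Z - {z} \<subseteq> A})" by (rule card_UN_le[OF Zf(1)])
  finally have "real (card {A \<in> \<F>. card (A \<inter> Z) \<ge> t + 1}) \<le> (\<Sum>z\<in>Z. real (card {A \<in> \<F>. Z - {z} \<subseteq> A}))"
    by (simp flip: of_nat_sum)
  also have "\<dots> = (\<Sum>z\<in>Z - Y. real (card {A \<in> \<F>. Z - {z} \<subseteq> A})) + (\<Sum>z\<in>Y. real (card {A \<in> \<F>. Z - {z} \<subseteq> A}))"
    using Y Zf by (intro sum.subset_diff)
  also have "\<dots> \<le> (\<Sum>z\<in>Z - Y. 5/27 * N) + (\<Sum>z\<in>Y. N)"
    using Y(1) by (intro add_mono sum_mono less all) auto
  also have "\<dots> = real (card Z - card Y) * (5/27 * N) + real (card Y) * N"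
    using Y by (simp add: card_Diff_subset)
  also have "\<dots> = (real t + 2) * (5/27 * N) + real (card Y) * (22/27 * N)"
  proof -
    have "card Y \<le> card Z" using Y Zf by (intro card_mono)
    then show ?thesis using Zf by (simp add: of_nat_diff field_simps)
  qed
  also have "\<dots> \<le> (real t + 2) * (5/27 * N) + 2 * (22/27 * N)"
    using \<open>card Y \<le> 2\<close> N_ge by (intro add_left_mono mult_right_mono) auto
  also have "\<dots> = 2 * N + 5/27 * real t * N" by (simp add: field_simps)
  finally show ?thesis .
qed

lemma subset_famA:
  assumes Z: "Z \<in> nsets {1..n} (t + 2)" and F: "\<F> \<subseteq> nsets {1..n} k" and G: "\<G> \<subseteq> nsets {1..n} k"
    and cross: "cross_intersecting t \<F> \<G>"
    and big: "real (card {A \<in> \<F>. card (A \<inter> Z) \<ge> t + 1}) > 2 * N + 5/27 * real t * N"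
  shows "\<G> \<subseteq> famA n k t Z"
proof
  fix B assume B: "B \<in> \<G>"
  have "\<not> card (B \<inter> Z) \<le> t"
  proof
    assume le: "card (B \<inter> Z) \<le> t"
    have "B \<in> nsets {1..n} k" using B G by auto
    moreover have "t \<le> card (A \<inter> B)" if "A \<in> \<F>" for A
      using cross that B by (simp add: cross_intersecting_def)
    ultimately show False using card_near_famA[OF Z F _ le] big by fastforce
  qed
  then show "B \<in> famA n k t Z" using B G by (auto simp: famA_def)
qed

section \<open>The extremal pairs\<close>

lemma card_covered_le:
  assumes F: "\<F> \<subseteq> nsets {1..n} k" and unc: "real (card (uncovered \<F> \<S>)) \<le> \<epsilon>"
    and up: "\<And>A F. A \<in> \<S> \<Longrightarrow> F \<in> \<F> \<Longrightarrow> A \<subseteq> F \<Longrightarrow> Q F"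
  shows "real (card \<F>) - \<epsilon> \<le> real (card {F \<in> \<F>. Q F})"
proof -
  have finF: "finite \<F>" using finite_nsets_sub[OF _ F] by simp
  have "\<F> \<subseteq> {F \<in> \<F>. Q F} \<union> uncovered \<F> \<S>" using up by (auto simp: uncovered_def)
  then have "card \<F> \<le> card ({F \<in> \<F>. Q F} \<union> uncovered \<F> \<S>)"
    using finF by (intro card_mono) (auto simp: uncovered_def)
  also have "\<dots> \<le> card {F \<in> \<F>. Q F} + card (uncovered \<F> \<S>)" by (rule card_Un_le)
  finally show ?thesis using unc by linarith
qed

text \<open>Each \<open>(t + 1)\<close>-set generates at most \<open>N\<close> members, so three of
  them cannot generate more than \<open>3 * N\<close>.\<close>

lemma card_kernel_ge:
  assumes F: "\<F> \<subseteq> nsets {1..n} k" and S: "\<And>A. A \<in> \<S> \<Longrightarrow> A \<subseteq> {1..n}"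
    and unc: "real (card (uncovered \<F> \<S>)) \<le> \<epsilon>" and big: "real (card \<F>) - \<epsilon> > 3 * N"
    and sz: "\<And>A. A \<in> \<S> \<Longrightarrow> card A = t + 1"
  shows "card \<S> \<ge> 4"
proof -
  have finF: "finite \<F>" using finite_nsets_sub[OF _ F] by simp
  have "\<S> \<subseteq> Pow {1..n}" using S by auto
  then have finS: "finite \<S>" by (rule finite_subset) simp
  have "real (card \<F>) - \<epsilon> \<le> real (card {F \<in> \<F>. \<exists>A\<in>\<S>. A \<subseteq> F})"
    by (rule card_covered_le[OF F unc]) blast
  also have "card {F \<in> \<F>. \<exists>A\<in>\<S>. A \<subseteq> F} = card (\<Union>A\<in>\<S>. {F \<in> \<F>. A \<subseteq> F})"
    by (rule arg_cong[of _ _ card]) blast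
  also have "real \<dots> \<le> real (\<Sum>A\<in>\<S>. card {F \<in> \<F>. A \<subseteq> F})"
    by (intro of_nat_mono card_UN_le finS)
  also have "\<dots> = (\<Sum>A\<in>\<S>. real (card {F \<in> \<F>. A \<subseteq> F}))" by simp
  also have "\<dots> \<le> (\<Sum>A\<in>\<S>. N)"
  proof (rule sum_mono)
    fix A assume A: "A \<in> \<S>"
    show "real (card {F \<in> \<F>. A \<subseteq> F}) \<le> N"
      using card_superset_le[OF F S[OF A] sz[OF A]] w_ge by simp
  qed
  also have "\<dots> = real (card \<S>) * N" by simp
  finally have "3 * N < real (card \<S>) * N" using big by linarith
  then have "3 < real (card \<S>)" using N_ge by (simp add: mult_less_cancel_right)
  then show ?thesis by simp
qed

lemma extremal_structure:
  assumes F: "\<F> \<subseteq> nsets {1..n} k" and G: "\<G> \<subseteq> nsets {1..n} k"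
    and cross: "cross_intersecting t \<F> \<G>" and nontriv: "card (\<Inter>F\<in>\<F> \<union> \<G>. F) < t"
    and A: "card (famA_std n k t) \<le> card \<F>" "card (famA_std n k t) \<le> card \<G>"
    and H: "card (famH_std n k t) \<le> card \<F>" "card (famH_std n k t) \<le> card \<G>"
  shows "(\<exists>X K L. X \<in> nsets {1..n} t \<and> K \<in> nsets {1..n} (k + 1) \<and> L \<in> nsets {1..n} (k + 1)
      \<and> X \<subseteq> K \<inter> L \<and> card (K \<inter> L) \<ge> t + 2 \<and> \<F> = famH n k X K L \<and> \<G> = famH n k X L K)
    \<or> (\<exists>Z\<in>nsets {1..n} (t + 2). \<F> = famA n k t Z \<and> \<G> = famA n k t Z)"
proof -
  have std: "{1..t + 2} \<in> nsets {1..n} (t + 2)" "{1..t} \<in> nsets {1..n} t" "{1..k + 1} \<in> nsets {1..n} (k + 1)"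
    using k_eq n_eq m_gt w_ge by (auto simp: nsets_def)
  have H_std: "card (famH_std n k t) = h + t"
    unfolding famH_std_def using std k_eq by (intro card_famH) auto
  have A_std: "real (card (famA_std n k t)) \<ge> (real t + 2) * N - (real t + 1) * p * N"
    unfolding famA_std_def by (rule card_famA_ge[OF std(1)])
  have bounds: "real (card \<A>) - E * N > 3 * N" "real (card \<A>) - E * N > 2 * N + 5/27 * real t * N"
      "real (card \<A>) - E * N > 3/5 * (real w + 1) * N" if "\<A> = \<F> \<or> \<A> = \<G>" for \<A>
  proof -
    have "card (famA_std n k t) \<le> card \<A>" "h \<le> card \<A>" using that A H H_std by auto
    then have "real (card \<A>) \<ge> (real t + 2) * N - (real t + 1) * p * N" "real (card \<A>) \<ge> real h"
      using A_std by linarith+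
    from threshold_bounds[OF this] show "real (card \<A>) - E * N > 3 * N"
      "real (card \<A>) - E * N > 2 * N + 5/27 * real t * N"
      "real (card \<A>) - E * N > 3/5 * (real w + 1) * N" .
  qed
  obtain \<S> \<S>' where ap: "approximates {1..n} t (t + 1) (E * N) \<F> \<G> (\<S>, \<S>')"
    by (rule peeling[OF F G cross])
  have sub: "A \<subseteq> {1..n} \<and> card A \<le> t + 1" if "A \<in> \<S> \<or> A \<in> \<S>'" for A
    using ap that by (auto simp: approximates_def)
  then have fin: "finite A \<and> card A \<le> t + 1" if "A \<in> \<S> \<or> A \<in> \<S>'" for A
    using that finite_subset[of A "{1..n}"] by simp
  have crS: "cross_intersecting t \<S> \<S>'" using ap by (simp add: approximates_def)
  have unc: "real (card (uncovered \<F> \<S>)) \<le> E * N" "real (card (uncovered \<G> \<S>')) \<le> E * N"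
    using ap by (simp_all add: approximates_def)
  \<comment> \<open>An empty kernel would leave the whole family uncovered.\<close>
  have ne: "\<S> \<noteq> {}" "\<S>' \<noteq> {}"
    using unc bounds(1)[of \<F>] bounds(1)[of \<G>] N_ge by (auto simp: uncovered_def)
  have four: "card \<S> \<ge> 4" if "\<And>A. A \<in> \<S> \<Longrightarrow> card A = t + 1"
    by (rule card_kernel_ge[OF F _ unc(1) _ that]) (use sub bounds(1)[of \<F>] in auto)
  have four': "card \<S>' \<ge> 4" if "\<And>A. A \<in> \<S>' \<Longrightarrow> card A = t + 1"
    by (rule card_kernel_ge[OF G _ unc(2) _ that]) (use sub bounds(1)[of \<G>] in auto)
  have "(\<exists>X. finite X \<and> card X = t \<and> (\<forall>A\<in>\<S> \<union> \<S>'. X \<subseteq> A)) \<or>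
    (\<exists>Z. finite Z \<and> card Z = t + 2 \<and> card \<S> \<ge> 4 \<and> (\<forall>A\<in>\<S> \<union> \<S>'. A \<subseteq> Z \<and> card A = t + 1))"
    by (rule kernel_structure[OF _ _ crS ne four four']) (use fin in auto)
  then show ?thesis
  proof (elim disjE exE conjE)
    fix X assume X: "finite X" "card X = t" "\<forall>A\<in>\<S> \<union> \<S>'. X \<subseteq> A"
    obtain A0 where "A0 \<in> \<S>" using ne by auto
    then have "X \<subseteq> {1..n}" using X(3) sub by blast
    then have XV: "X \<in> nsets {1..n} t" using X by (simp add: nsets_def)
    have bF: "real (card \<F>) - E * N \<le> real (card {F \<in> \<F>. X \<subseteq> F})"
      by (rule card_covered_le[OF F unc(1)]) (use X(3) in blast)
    have bG: "real (card \<G>) - E * N \<le> real (card {F \<in> \<G>. X \<subseteq> F})"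
      by (rule card_covered_le[OF G unc(2)]) (use X(3) in blast)
    have "\<not> (\<forall>A\<in>\<F> \<union> \<G>. X \<subseteq> A)"
    proof
      assume "\<forall>A\<in>\<F> \<union> \<G>. X \<subseteq> A"
      then have XI: "X \<subseteq> (\<Inter>F\<in>\<F> \<union> \<G>. F)" by auto
      \<comment> \<open>Needed for finiteness: over an empty union the intersection is
        \<open>UNIV\<close>, whose \<open>card\<close> is 0.\<close>
      have "\<F> \<noteq> {}" using H_std H(1) t_ge by auto
      then obtain F0 where F0: "F0 \<in> \<F>" by auto
      then have "finite F0" using F by (auto simp: nsets_def)
      then have "finite (\<Inter>F\<in>\<F> \<union> \<G>. F)" using F0 by (meson INT_lower UnI1 finite_subset)
      from card_mono[OF this XI] show False using nontriv X by simp
    qed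
    note sc = star_case[OF XV F G cross _ _ _ _ _ _ this]
    show ?thesis
      by (rule disjI1, rule sc)
        (use bF bG bounds[of \<F>] bounds[of \<G>] H H_std in simp_all)
  next
    fix Z assume Z: "finite Z" "card Z = t + 2" "card \<S> \<ge> 4" "\<forall>A\<in>\<S> \<union> \<S>'. A \<subseteq> Z \<and> card A = t + 1"
    have "card \<S> \<ge> 2" using Z by simp
    then obtain R where "R \<subseteq> \<S>" "card R = 2" by (meson obtain_subset_with_card_n)
    then obtain A1 A2 where A12: "A1 \<in> \<S>" "A2 \<in> \<S>" "A1 \<noteq> A2" by (auto simp: card_2_iff)
    have Z12: "A1 \<subseteq> Z" "A2 \<subseteq> Z" "card A1 = t + 1" "card A2 = t + 1" using Z(4) A12 by auto
    \<comment> \<open>Two distinct \<open>(t + 1)\<close>-subsets of \<open>Z\<close> cover it,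
      which puts \<open>Z\<close> inside \<open>{1..n}\<close>.\<close>
    have "Z \<subseteq> A1 \<union> A2"
    proof (rule ccontr)
      assume "\<not> Z \<subseteq> A1 \<union> A2"
      then obtain z where z: "z \<in> Z" "z \<notin> A1" "z \<notin> A2" by auto
      have "A1 = Z - {z}" "A2 = Z - {z}" using z Z Z12 by (intro card_seteq; auto)+
      then show False using A12 by simp
    qed
    then have "Z \<subseteq> {1..n}" using sub A12 by blast
    then have ZV: "Z \<in> nsets {1..n} (t + 2)" using Z by (simp add: nsets_def)
    have up: "t + 1 \<le> card (F \<inter> Z)" if "A \<in> \<S> \<union> \<S>'" "A \<subseteq> F" for A F
    proof -
      have "A \<subseteq> F \<inter> Z" "card A = t + 1" using Z(4) that by auto
      then show ?thesis using card_mono[of "F \<inter> Z" A] Z(1) by simp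
    qed
    have bF: "real (card \<F>) - E * N \<le> real (card {F \<in> \<F>. t + 1 \<le> card (F \<inter> Z)})"
      by (rule card_covered_le[OF F unc(1)]) (use up in blast)
    have bG: "real (card \<G>) - E * N \<le> real (card {F \<in> \<G>. t + 1 \<le> card (F \<inter> Z)})"
      by (rule card_covered_le[OF G unc(2)]) (use up in blast)
    have "\<G> \<subseteq> famA n k t Z"
      by (rule subset_famA[OF ZV F G cross]) (use bF bounds(2)[of \<F>] in simp)
    moreover have "\<F> \<subseteq> famA n k t Z"
      by (rule subset_famA[OF ZV G F cross[unfolded cross_intersecting_sym[of t \<F> \<G>]]])
        (use bG bounds(2)[of \<G>] in simp)
    moreover have "finite (famA n k t Z)" by (simp add: famA_def finite_imp_finite_nsets)
    moreover have "card (famA n k t Z) = card (famA_std n k t)"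
      unfolding famA_std_def card_famA[OF ZV] card_famA[OF std(1)] by simp
    ultimately have "\<F> = famA n k t Z" "\<G> = famA n k t Z"
      using A card_seteq[of "famA n k t Z" \<F>] card_seteq[of "famA n k t Z" \<G>] by simp_all
    then show ?thesis using ZV by blast
  qed
qed

end

theorem theorem1p5:
  fixes n k t :: nat and \<F> \<G> :: "nat set set"
  assumes "k \<ge> t + 2" and "t + 2 \<ge> 4"
    and "\<F> \<subseteq> nsets {1..n} k" and "\<G> \<subseteq> nsets {1..n} k"
    and "cross_intersecting t \<F> \<G>"
    and "card (\<Inter>F\<in>\<F> \<union> \<G>. F) < t"
    and "real n \<ge> real t + (real k - real t) * max (30 * (real t + 2)) (2 * exp 1 * real k)"
  shows "min (card \<F>) (card \<G>) \<le> max (card (famA_std n k t)) (card (famH_std n k t))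
    \<and> (min (card \<F>) (card \<G>) = max (card (famA_std n k t)) (card (famH_std n k t)) \<longrightarrow>
        (\<exists>X K L. X \<in> nsets {1..n} t \<and> K \<in> nsets {1..n} (k + 1) \<and> L \<in> nsets {1..n} (k + 1)
            \<and> X \<subseteq> K \<inter> L \<and> card (K \<inter> L) \<ge> t + 2
            \<and> \<F> = famH n k X K L \<and> \<G> = famH n k X L K)
      \<or> (\<exists>Z \<in> nsets {1..n} (t + 2). \<F> = famA n k t Z \<and> \<G> = famA n k t Z))"
proof -
  define w m where "w = k - t" "m = n - t"
  have w: "real k - real t = real w" "k = t + w" using assms(1) by (simp_all add: w_m_def of_nat_diff)
  \<comment> \<open>This yields \<open>t \<le> n\<close>, so that \<open>n - t\<close> is not
    truncated.\<close>
  have "0 \<le> real w * max (30 * (real t + 2)) (2 * exp 1 * real k)"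
    by (intro mult_nonneg_nonneg) (auto simp: le_max_iff_disj)
  then have "real t \<le> real n" using assms(7) unfolding w(1) by linarith
  then have "t \<le> n" by simp
  then have m: "n = t + m" "real n - real t = real m" by (simp_all add: w_m_def of_nat_diff)
  have bound: "real w * max (30 * (real t + 2)) (2 * exp 1 * real k) \<le> real m"
    using assms(7) m(2) unfolding w(1) by linarith
  have "real w * (30 * (real t + 2)) \<le> real w * max (30 * (real t + 2)) (2 * exp 1 * real k)"
    by (intro mult_left_mono) auto
  then have "real w * (30 * (real t + 2)) \<le> real m" using bound by linarith
  then have "real (30 * (t + 2) * w) \<le> real m" by (simp add: algebra_simps)
  then have m30: "30 * (t + 2) * w \<le> m" by (simp only: of_nat_le_iff)
  have "real w * (2 * exp 1 * real k) \<le> real w * max (30 * (real t + 2)) (2 * exp 1 * real k)"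
    by (intro mult_left_mono) auto
  then have me: "2 * exp 1 * real k * real w \<le> real m" using bound by (simp add: mult_ac)
  interpret large_n n k t w m
    by unfold_locales (use assms w m m30 me in simp_all)
  let ?M = "max (card (famA_std n k t)) (card (famH_std n k t))"
  let ?H = "\<exists>X K L. X \<in> nsets {1..n} t \<and> K \<in> nsets {1..n} (k + 1) \<and> L \<in> nsets {1..n} (k + 1)
            \<and> X \<subseteq> K \<inter> L \<and> card (K \<inter> L) \<ge> t + 2
            \<and> \<F> = famH n k X K L \<and> \<G> = famH n k X L K"
  let ?A = "\<exists>Z \<in> nsets {1..n} (t + 2). \<F> = famA n k t Z \<and> \<G> = famA n k t Z"
  have extremal: "?H \<or> ?A" if "?M \<le> min (card \<F>) (card \<G>)"
    by (rule extremal_structure[OF assms(3-6)]) (use that in simp_all)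
  have "min (card \<F>) (card \<G>) \<le> ?M"
  proof (rule ccontr)
    assume "\<not> min (card \<F>) (card \<G>) \<le> ?M"
    then have gt: "?M < min (card \<F>) (card \<G>)" by (simp only: not_le)
    have std: "{1..t + 2} \<in> nsets {1..n} (t + 2)" "{1..t} \<in> nsets {1..n} t" "{1..k + 1} \<in> nsets {1..n} (k + 1)"
      using k_eq n_eq m_gt w_ge by (auto simp: nsets_def)
    \<comment> \<open>Either form makes \<F> exactly as large as a standard family, hence not larger
      than \<open>?M\<close>.\<close>
    have "?H \<or> ?A" by (rule extremal[OF less_imp_le[OF gt]])
    then show False
    proof (elim disjE exE conjE bexE)
      fix X K L
      assume XKL: "X \<in> nsets {1..n} t" "K \<in> nsets {1..n} (k + 1)" "L \<in> nsets {1..n} (k + 1)"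
        "X \<subseteq> K \<inter> L" and eq: "\<F> = famH n k X K L"
      have "card (famH_std n k t) = h + t"
        unfolding famH_std_def using std k_eq by (intro card_famH) auto
      then show False using card_famH[OF XKL] eq gt by simp
    next
      fix Z assume Z: "Z \<in> nsets {1..n} (t + 2)" and eq: "\<F> = famA n k t Z"
      have "card (famA_std n k t) = card \<F>"
        unfolding famA_std_def eq card_famA[OF Z] card_famA[OF std(1)] by simp
      then show False using gt by simp
    qed
  qed
  moreover have "min (card \<F>) (card \<G>) = ?M \<longrightarrow> ?H \<or> ?A"
  proof
    assume "min (card \<F>) (card \<G>) = ?M"
    then show "?H \<or> ?A" by (intro extremal) (simp only: order_refl)
  qed
  ultimately show ?thesis by (rule conjI)
qed

end
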